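(* Let $T$ be a theory. (1) The following are equivalent: $T$ is unstable; $T$ trace defines $(\mathbb{Q};<)$; $T$ trace defines some infinite linear order. (2) The following are equivalent: $T$ is $\mathrm{IP}$ (has the independence property); $T$ trace defines the Erdős-Rado graph; $T$ trace defines the generic binary relation.
   Context: Conventions: structures and theories are first order; theories are complete, consistent and deductively closed; "definable" means definable with parameters. A trace definition of a structure $\mathcal{M}$ in a structure $\mathcal{N}$ is a map $\tau\colon M\to N^n$ (some $n\ge 1$) such that for every $m\ge 1$ and every $\mathcal{M}$-definable $X\subseteq M^m$ there is an $\mathcal{N}$-definable $Y\subseteq N^{mn}$ with $X=\{(a_1,\dots,a_m)\in M^m : (\tau(a_1),\dots,\tau(a_m))\in Y\}$ (such a $\tau$ is automatically injective). $\mathcal{N}$ trace defines $\mathcal{M}$ if such a $\tau$ exists. A theory $T$ trace defines $\mathcal{M}$ if some model of $T$ trace defines $\mathcal{M}$. The Erdős-Rado graph is the Fraïssé limit of the class of finite graphs; the generic binary relation is the Fraïssé limit of the class of all finite sets equipped with a binary relation. *)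

theory Defs
  imports Complex_Main "HOL-Library.Countable_Set" "HOL-Library.Equipollence"
begin

section \<open>First-order languages, structures and satisfaction\<close>

text \<open>
  The symbols of a language are the elements of the sets \<open>Funs\<close> and \<open>Rels\<close>; constants are
  function symbols of arity 0. Languages may be uncountable. Equality is a logical symbol.
\<close>

record ('f, 'r) language =
  Funs :: "'f set"
  Rels :: "'r set"
  fun_ar :: "'f \<Rightarrow> nat"
  rel_ar :: "'r \<Rightarrow> nat"

datatype 'f trm = Var nat | App 'f "'f trm list"

datatype ('f, 'r) form =
    Equal "'f trm" "'f trm"
  | Rel 'r "'f trm list"
  | Neg "('f, 'r) form"
  | Conj "('f, 'r) form" "('f, 'r) form"
  | Ex nat "('f, 'r) form"

fun wf_trm :: "('f, 'r) language \<Rightarrow> 'f trm \<Rightarrow> bool" where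
  "wf_trm L (Var i) \<longleftrightarrow> True"
| "wf_trm L (App f ts) \<longleftrightarrow> f \<in> Funs L \<and> length ts = fun_ar L f \<and> (\<forall>t\<in>set ts. wf_trm L t)"

fun wf_form :: "('f, 'r) language \<Rightarrow> ('f, 'r) form \<Rightarrow> bool" where
  "wf_form L (Equal s t) \<longleftrightarrow> wf_trm L s \<and> wf_trm L t"
| "wf_form L (Rel r ts) \<longleftrightarrow> r \<in> Rels L \<and> length ts = rel_ar L r \<and> (\<forall>t\<in>set ts. wf_trm L t)"
| "wf_form L (Neg \<phi>) \<longleftrightarrow> wf_form L \<phi>"
| "wf_form L (Conj \<phi> \<psi>) \<longleftrightarrow> wf_form L \<phi> \<and> wf_form L \<psi>"
| "wf_form L (Ex i \<phi>) \<longleftrightarrow> wf_form L \<phi>"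

fun trm_vars :: "'f trm \<Rightarrow> nat set" where
  "trm_vars (Var i) = {i}"
| "trm_vars (App f ts) = (\<Union>t\<in>set ts. trm_vars t)"

fun free_vars :: "('f, 'r) form \<Rightarrow> nat set" where
  "free_vars (Equal s t) = trm_vars s \<union> trm_vars t"
| "free_vars (Rel r ts) = (\<Union>t\<in>set ts. trm_vars t)"
| "free_vars (Neg \<phi>) = free_vars \<phi>"
| "free_vars (Conj \<phi> \<psi>) = free_vars \<phi> \<union> free_vars \<psi>"
| "free_vars (Ex i \<phi>) = free_vars \<phi> - {i}"

definition sentences :: "('f, 'r) language \<Rightarrow> ('f, 'r) form set" where
  "sentences L = {\<phi>. wf_form L \<phi> \<and> free_vars \<phi> = {}}"

record ('f, 'r, 'a) struct =
  universe :: "'a set"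
  fun_of :: "'f \<Rightarrow> 'a list \<Rightarrow> 'a"
  rel_of :: "'r \<Rightarrow> 'a list \<Rightarrow> bool"

definition closed_under :: "('f, 'r) language \<Rightarrow> ('f, 'r, 'a) struct \<Rightarrow> 'a set \<Rightarrow> bool" where
  "closed_under L M S \<longleftrightarrow>
     (\<forall>f\<in>Funs L. \<forall>xs. set xs \<subseteq> S \<and> length xs = fun_ar L f \<longrightarrow> fun_of M f xs \<in> S)"

text \<open>
  The values of \<open>fun_of\<close> and \<open>rel_of\<close> on symbols outside of \<open>L\<close>, on lists of the wrong length and
  on lists with entries outside of the universe are junk, and are ignored by all notions below.
\<close>

definition is_struct :: "('f, 'r) language \<Rightarrow> ('f, 'r, 'a) struct \<Rightarrow> bool" where
  "is_struct L M \<longleftrightarrow> universe M \<noteq> {} \<and> closed_under L M (universe M)"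

fun trm_val :: "('f, 'r, 'a) struct \<Rightarrow> (nat \<Rightarrow> 'a) \<Rightarrow> 'f trm \<Rightarrow> 'a" where
  "trm_val M v (Var i) = v i"
| "trm_val M v (App f ts) = fun_of M f (map (trm_val M v) ts)"

fun sat :: "('f, 'r, 'a) struct \<Rightarrow> (nat \<Rightarrow> 'a) \<Rightarrow> ('f, 'r) form \<Rightarrow> bool" where
  "sat M v (Equal s t) \<longleftrightarrow> trm_val M v s = trm_val M v t"
| "sat M v (Rel r ts) \<longleftrightarrow> rel_of M r (map (trm_val M v) ts)"
| "sat M v (Neg \<phi>) \<longleftrightarrow> \<not> sat M v \<phi>"
| "sat M v (Conj \<phi> \<psi>) \<longleftrightarrow> sat M v \<phi> \<and> sat M v \<psi>"
| "sat M v (Ex i \<phi>) \<longleftrightarrow> (\<exists>a\<in>universe M. sat M (v(i := a)) \<phi>)"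

definition satisfies :: "('f, 'r, 'a) struct \<Rightarrow> ('f, 'r) form \<Rightarrow> bool" where
  "satisfies M \<phi> \<longleftrightarrow> (\<forall>v. range v \<subseteq> universe M \<longrightarrow> sat M v \<phi>)"

definition is_model :: "('f, 'r) language \<Rightarrow> ('f, 'r) form set \<Rightarrow> ('f, 'r, 'a) struct \<Rightarrow> bool" where
  "is_model L T M \<longleftrightarrow> is_struct L M \<and> (\<forall>\<phi>\<in>T. satisfies M \<phi>)"


section \<open>Complete theories\<close>

text \<open>
  HOL cannot quantify over the class of all structures, so quantification over models of a theory
  always means models whose universe is a subset of a fixed type \<open>'u\<close>, passed as \<open>TYPE('u)\<close>. When
  \<open>'u\<close> is infinite and at least as large as the language, the Loewenheim-Skolem theorem shows that
  the notions below do not depend on \<open>'u\<close>. In particular, by completeness of first-order logic,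
  having a model is consistency and semantic consequence is provability.
\<close>

definition large_type :: "'u itself \<Rightarrow> ('f, 'r) language \<Rightarrow> bool" where
  "large_type U L \<longleftrightarrow>
     infinite (UNIV :: 'u set) \<and> Funs L \<lesssim> (UNIV :: 'u set) \<and> Rels L \<lesssim> (UNIV :: 'u set)"

definition consistent :: "'u itself \<Rightarrow> ('f, 'r) language \<Rightarrow> ('f, 'r) form set \<Rightarrow> bool" where
  "consistent U L T \<longleftrightarrow> (\<exists>M :: ('f, 'r, 'u) struct. is_model L T M)"

definition deductively_closed :: "'u itself \<Rightarrow> ('f, 'r) language \<Rightarrow> ('f, 'r) form set \<Rightarrow> bool" where
  "deductively_closed U L T \<longleftrightarrow>
     (\<forall>\<phi>\<in>sentences L. (\<forall>M :: ('f, 'r, 'u) struct. is_model L T M \<longrightarrow> satisfies M \<phi>) \<longrightarrow> \<phi> \<in> T)"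

definition complete_theory :: "'u itself \<Rightarrow> ('f, 'r) language \<Rightarrow> ('f, 'r) form set \<Rightarrow> bool" where
  "complete_theory U L T \<longleftrightarrow>
     T \<subseteq> sentences L \<and> consistent U L T \<and> deductively_closed U L T \<and>
     (\<forall>\<phi>\<in>sentences L. \<phi> \<in> T \<or> Neg \<phi> \<in> T)"


section \<open>Stability and the independence property\<close>

text \<open>
  A partitioned formula \<open>\<phi>(x;y)\<close> with \<open>x\<close> of length \<open>k\<close> and \<open>y\<close> of length \<open>l\<close> is a formula with free
  variables among \<open>0, \<dots>, k + l - 1\<close>, evaluated at \<open>(a;b)\<close> under the valuation \<open>nth (a @ b)\<close>.
\<close>

definition tuples :: "nat \<Rightarrow> 'a set \<Rightarrow> 'a list set" where
  "tuples n A = {xs. length xs = n \<and> set xs \<subseteq> A}"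

definition has_order_property ::
    "('f, 'r, 'a) struct \<Rightarrow> nat \<Rightarrow> nat \<Rightarrow> ('f, 'r) form \<Rightarrow> bool" where
  "has_order_property M k l \<phi> \<longleftrightarrow>
     (\<exists>a b. (\<forall>i :: nat. a i \<in> tuples k (universe M) \<and> b i \<in> tuples l (universe M)) \<and>
            (\<forall>i j. sat M (nth (a i @ b j)) \<phi> \<longleftrightarrow> i < j))"

definition unstable :: "'u itself \<Rightarrow> ('f, 'r) language \<Rightarrow> ('f, 'r) form set \<Rightarrow> bool" where
  "unstable U L T \<longleftrightarrow>
     (\<exists>(M :: ('f, 'r, 'u) struct) k l \<phi>.
        is_model L T M \<and> wf_form L \<phi> \<and> free_vars \<phi> \<subseteq> {..<k + l} \<and> has_order_property M k l \<phi>)"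

definition shatters ::
    "('f, 'r, 'a) struct \<Rightarrow> nat \<Rightarrow> nat \<Rightarrow> ('f, 'r) form \<Rightarrow> nat \<Rightarrow> bool" where
  "shatters M k l \<phi> n \<longleftrightarrow>
     (\<exists>a b. (\<forall>i<n. a i \<in> tuples k (universe M)) \<and>
            (\<forall>I\<subseteq>{..<n}. b I \<in> tuples l (universe M)) \<and>
            (\<forall>i<n. \<forall>I\<subseteq>{..<n}. sat M (nth (a i @ b I)) \<phi> \<longleftrightarrow> i \<in> I))"

definition has_IP :: "'u itself \<Rightarrow> ('f, 'r) language \<Rightarrow> ('f, 'r) form set \<Rightarrow> bool" where
  "has_IP U L T \<longleftrightarrow>
     (\<exists>(M :: ('f, 'r, 'u) struct) k l \<phi>.
        is_model L T M \<and> wf_form L \<phi> \<and> free_vars \<phi> \<subseteq> {..<k + l} \<and> (\<forall>n. shatters M k l \<phi> n))"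


section \<open>Trace definitions\<close>

text \<open>Definable with parameters; \<open>ps\<close> is the tuple of parameters.\<close>

definition definable ::
    "('f, 'r) language \<Rightarrow> ('f, 'r, 'a) struct \<Rightarrow> nat \<Rightarrow> 'a list set \<Rightarrow> bool" where
  "definable L M m X \<longleftrightarrow>
     (\<exists>\<phi> ps. wf_form L \<phi> \<and> set ps \<subseteq> universe M \<and> free_vars \<phi> \<subseteq> {..<m + length ps} \<and>
             X = {xs \<in> tuples m (universe M). sat M (nth (xs @ ps)) \<phi>})"

definition trace_definition ::
    "('f, 'r) language \<Rightarrow> ('f, 'r, 'b) struct \<Rightarrow> ('g, 's) language \<Rightarrow> ('g, 's, 'a) struct \<Rightarrow>
     nat \<Rightarrow> ('a \<Rightarrow> 'b list) \<Rightarrow> bool" where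
  "trace_definition L N L' M n \<tau> \<longleftrightarrow>
     n \<ge> 1 \<and> (\<forall>a\<in>universe M. \<tau> a \<in> tuples n (universe N)) \<and>
     (\<forall>m\<ge>1. \<forall>X. definable L' M m X \<longrightarrow>
        (\<exists>Y. definable L N (m * n) Y \<and>
             X = {as \<in> tuples m (universe M). concat (map \<tau> as) \<in> Y}))"

definition struct_trace_defines ::
    "('f, 'r) language \<Rightarrow> ('f, 'r, 'b) struct \<Rightarrow> ('g, 's) language \<Rightarrow> ('g, 's, 'a) struct \<Rightarrow> bool" where
  "struct_trace_defines L N L' M \<longleftrightarrow> (\<exists>n \<tau>. trace_definition L N L' M n \<tau>)"

definition theory_trace_defines ::
    "'u itself \<Rightarrow> ('f, 'r) language \<Rightarrow> ('f, 'r) form set \<Rightarrow>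
     ('g, 's) language \<Rightarrow> ('g, 's, 'a) struct \<Rightarrow> bool" where
  "theory_trace_defines U L T L' M \<longleftrightarrow>
     (\<exists>N :: ('f, 'r, 'u) struct. is_model L T N \<and> struct_trace_defines L N L' M)"


section \<open>Age and Fraisse limits\<close>

definition embedding ::
    "('f, 'r) language \<Rightarrow> ('f, 'r, 'a) struct \<Rightarrow> ('f, 'r, 'b) struct \<Rightarrow> ('a \<Rightarrow> 'b) \<Rightarrow> bool" where
  "embedding L A B h \<longleftrightarrow>
     h ` universe A \<subseteq> universe B \<and> inj_on h (universe A) \<and>
     (\<forall>f\<in>Funs L. \<forall>xs\<in>tuples (fun_ar L f) (universe A). h (fun_of A f xs) = fun_of B f (map h xs)) \<and>
     (\<forall>r\<in>Rels L. \<forall>xs\<in>tuples (rel_ar L r) (universe A). rel_of A r xs \<longleftrightarrow> rel_of B r (map h xs))"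

definition isomorphism ::
    "('f, 'r) language \<Rightarrow> ('f, 'r, 'a) struct \<Rightarrow> ('f, 'r, 'b) struct \<Rightarrow> ('a \<Rightarrow> 'b) \<Rightarrow> bool" where
  "isomorphism L A B h \<longleftrightarrow> embedding L A B h \<and> h ` universe A = universe B"

definition finitely_generated :: "('f, 'r) language \<Rightarrow> ('f, 'r, 'a) struct \<Rightarrow> bool" where
  "finitely_generated L A \<longleftrightarrow>
     (\<exists>S. finite S \<and> S \<subseteq> universe A \<and>
          (\<forall>C. S \<subseteq> C \<and> C \<subseteq> universe A \<and> closed_under L A C \<longrightarrow> C = universe A))"

definition substruct ::
    "('f, 'r) language \<Rightarrow> ('f, 'r, 'a) struct \<Rightarrow> ('f, 'r, 'a) struct \<Rightarrow> bool" where
  "substruct L A M \<longleftrightarrow> is_struct L A \<and> (\<exists>S\<subseteq>universe M. A = M\<lparr>universe := S\<rparr>)"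

definition ultrahomogeneous :: "('f, 'r) language \<Rightarrow> ('f, 'r, 'a) struct \<Rightarrow> bool" where
  "ultrahomogeneous L M \<longleftrightarrow>
     (\<forall>A B h. substruct L A M \<and> finitely_generated L A \<and> substruct L B M \<and> finitely_generated L B \<and>
        isomorphism L A B h \<longrightarrow>
        (\<exists>g. isomorphism L M M g \<and> (\<forall>x\<in>universe A. g x = h x)))"

text \<open>
  The class \<open>K\<close> is given by its members with universe a set of natural numbers. Up to isomorphism
  this loses nothing when the language is countable, as finitely generated structures are then
  countable.
\<close>

definition age :: "('f, 'r) language \<Rightarrow> ('f, 'r, 'a) struct \<Rightarrow> ('f, 'r, nat) struct set" where
  "age L M = {A. is_struct L A \<and> finitely_generated L A \<and> (\<exists>h. embedding L A M h)}"

definition fraisse_limit ::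
    "('f, 'r) language \<Rightarrow> ('f, 'r, nat) struct set \<Rightarrow> ('f, 'r, 'a) struct \<Rightarrow> bool" where
  "fraisse_limit L K M \<longleftrightarrow>
     is_struct L M \<and> countable (universe M) \<and> ultrahomogeneous L M \<and> age L M = K"


section \<open>Structures with one binary relation\<close>

definition binary_language :: "(unit, unit) language" where
  "binary_language = \<lparr>Funs = {}, Rels = {()}, fun_ar = (\<lambda>_. 0), rel_ar = (\<lambda>_. 2)\<rparr>"

definition binary_struct :: "'a set \<Rightarrow> ('a \<times> 'a) set \<Rightarrow> (unit, unit, 'a) struct" where
  "binary_struct A E =
     \<lparr>universe = A, fun_of = (\<lambda>_ _. undefined), rel_of = (\<lambda>_ xs. (xs ! 0, xs ! 1) \<in> E)\<rparr>"

definition rat_order :: "(unit, unit, rat) struct" where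
  "rat_order = binary_struct UNIV {(x, y). x < y}"

definition finite_binary_structs :: "(unit, unit, nat) struct set" where
  "finite_binary_structs = {A. is_struct binary_language A \<and> finite (universe A)}"

definition finite_graphs :: "(unit, unit, nat) struct set" where
  "finite_graphs =
     {A \<in> finite_binary_structs.
        (\<forall>x\<in>universe A. \<not> rel_of A () [x, x]) \<and>
        (\<forall>x\<in>universe A. \<forall>y\<in>universe A. rel_of A () [x, y] \<longrightarrow> rel_of A () [y, x])}"

text \<open>Fraisse limits are unique only up to isomorphism, hence predicates rather than constants.\<close>

definition is_erdos_rado_graph :: "(unit, unit, 'a) struct \<Rightarrow> bool" where
  "is_erdos_rado_graph G \<longleftrightarrow> fraisse_limit binary_language finite_graphs G"

definition is_generic_binary_relation :: "(unit, unit, 'a) struct \<Rightarrow> bool" where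
  "is_generic_binary_relation R \<longleftrightarrow> fraisse_limit binary_language finite_binary_structs R"

end

theory Submission
  imports Defs
begin

text \<open>
  If \<open>\<phi>(x;y)\<close> has the order property
  (the independence property), then by compactness a model of \<open>T\<close> in the given type contains tuples
  \<open>a\<^sub>i\<close>, \<open>b\<^sub>j\<close> on which \<open>\<phi>\<close> codes the order of the rationals (any given countable binary relation).
  Mapping the \<open>i\<close>-th point to its tuples traces the atomic formulas, and these suffice: in a binary
  structure with the one-point extension property, definable sets are finite unions of atomic types.
  The compactness used is an ultrapower indexed by the naturals, followed by the downward
  Loewenheim-Skolem theorem to return to the given type.

  Conversely, the trace of an infinite linear order on a monotone sequence has the order property
  (for a decreasing sequence after negation and a shift by one), and the trace of a structure that
  embeds all finite graphs shatters every finite set via a bipartite membership graph.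
\<close>

section \<open>Satisfaction\<close>

text \<open>What has to be realized is one countable pattern for one formula, never a full type; so
  a single nonprincipal ultrafilter on the naturals gives enough saturation, even for uncountable
  languages. The ultrapower lives in a function type, whereas \<open>theory_trace_defines\<close>
  asks for a model in the given type; this forces the return by Loewenheim-Skolem and with it a
  bound on the number of formulas. A trace must account for every definable set, with parameters.
  What makes this manageable is finiteness: truth of a formula depends only on the finite atomic
  diagram of its arguments and parameters. Equality belongs to that diagram. It is coded into the
  pattern, so that the injectivity of the trace map does not have to be arranged separately. The
  extension property comes from density for the rationals and from ultrahomogeneity for Fraisse
  limits, so all target structures share one argument.\<close>

lemma trm_val_cong: "(\<And>i. i \<in> trm_vars t \<Longrightarrow> v i = w i) \<Longrightarrow> trm_val M v t = trm_val M w t"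
proof (induction t)
  case (App f ts)
  then have "map (trm_val M v) ts = map (trm_val M w) ts" by fastforce
  then show ?case by (simp del: map_eq_conv)
qed simp

lemma map_trm_val_cong:
  "(\<And>i. i \<in> (\<Union>t\<in>set ts. trm_vars t) \<Longrightarrow> v i = w i) \<Longrightarrow> map (trm_val M v) ts = map (trm_val M w) ts"
  by (rule map_cong[OF refl], rule trm_val_cong) auto

lemma sat_cong: "(\<And>i. i \<in> free_vars \<phi> \<Longrightarrow> v i = w i) \<Longrightarrow> sat M v \<phi> \<longleftrightarrow> sat M w \<phi>"
proof (induction \<phi> arbitrary: v w)
  case (Equal s t)
  then show ?case using trm_val_cong[of s v w M] trm_val_cong[of t v w M] by auto
next
  case (Rel r ts)
  then show ?case using map_trm_val_cong[of ts v w M] by (simp del: map_eq_conv)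
next
  case (Neg \<phi>)
  have "sat M v \<phi> \<longleftrightarrow> sat M w \<phi>" by (rule Neg.IH) (simp add: Neg.prems)
  then show ?case by simp
next
  case (Conj \<phi> \<psi>)
  have "sat M v \<phi> \<longleftrightarrow> sat M w \<phi>" by (rule Conj.IH) (simp add: Conj.prems)
  moreover have "sat M v \<psi> \<longleftrightarrow> sat M w \<psi>" by (rule Conj.IH) (simp add: Conj.prems)
  ultimately show ?case by simp
next
  case (Ex i \<phi>)
  have "sat M (v(i := a)) \<phi> \<longleftrightarrow> sat M (w(i := a)) \<phi>" for a
    by (rule Ex.IH) (simp add: Ex.prems)
  then show ?case by simp
qed

lemma finite_trm_vars [simp]: "finite (trm_vars t)"
  by (induction t) auto

lemma finite_free_vars [simp]: "finite (free_vars \<phi>)"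
  by (induction \<phi>) auto

lemma trm_val_closed:
  assumes "closed_under L M S" "wf_trm L t" "\<And>i. i \<in> trm_vars t \<Longrightarrow> v i \<in> S"
  shows "trm_val M v t \<in> S"
  using assms(2,3)
proof (induction t)
  case (App f ts)
  then have "set (map (trm_val M v) ts) \<subseteq> S" by fastforce
  then show ?case using App.prems assms(1) by (auto simp: closed_under_def)
qed simp

lemma trm_val_embedding:
  assumes "is_struct L M" "embedding L M N h" "wf_trm L t" "range v \<subseteq> universe M"
  shows "h (trm_val M v t) = trm_val N (h \<circ> v) t"
  using assms(3)
proof (induction t)
  case (App f ts)
  have "set (map (trm_val M v) ts) \<subseteq> universe M"
    using assms(1,4) App.prems by (auto simp: is_struct_def intro!: trm_val_closed)
  then have "h (fun_of M f (map (trm_val M v) ts)) = fun_of N f (map h (map (trm_val M v) ts))"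
    using assms(2) App.prems unfolding embedding_def tuples_def by auto
  also have "map h (map (trm_val M v) ts) = map (trm_val N (h \<circ> v)) ts"
    using App by (simp add: comp_def)
  finally show ?case by (simp add: comp_def)
qed simp

lemma sat_isomorphism:
  assumes M: "is_struct L M" and h: "isomorphism L M N h"
  shows "wf_form L \<phi> \<Longrightarrow> range v \<subseteq> universe M \<Longrightarrow> sat M v \<phi> \<longleftrightarrow> sat N (h \<circ> v) \<phi>"
proof (induction \<phi> arbitrary: v)
  have e: "embedding L M N h" and inj: "inj_on h (universe M)" and sur: "h ` universe M = universe N"
    using h by (auto simp: isomorphism_def embedding_def)
  have cl: "trm_val M v t \<in> universe M" if "wf_trm L t" "range v \<subseteq> universe M" for v t
    using M that by (auto simp: is_struct_def intro!: trm_val_closed)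
  note hom = trm_val_embedding[OF M e]
  {
    case (Equal s t)
    then have "trm_val M v s = trm_val M v t \<longleftrightarrow> h (trm_val M v s) = h (trm_val M v t)"
      using inj_on_eq_iff[OF inj cl cl] by simp
    then show ?case using Equal hom by (simp add: comp_def)
  next
    case (Rel r ts)
    then have "map (trm_val N (h \<circ> v)) ts = map h (map (trm_val M v) ts)"
      by (auto simp: hom)
    moreover have "map (trm_val M v) ts \<in> tuples (rel_ar L r) (universe M)"
      using Rel by (auto simp: tuples_def cl)
    then have "rel_of M r (map (trm_val M v) ts) \<longleftrightarrow> rel_of N r (map h (map (trm_val M v) ts))"
      using e Rel.prems unfolding embedding_def by (auto simp del: map_map)
    ultimately show ?case by (simp only: sat.simps)
  next
    case (Neg \<phi>)
    then show ?case by simp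
  next
    case (Conj \<phi> \<psi>)
    then show ?case by simp
  next
    case (Ex i \<phi>)
    have "sat M (v(i := a)) \<phi> \<longleftrightarrow> sat N ((h \<circ> v)(i := h a)) \<phi>" if "a \<in> universe M" for a
    proof -
      have eq: "h \<circ> v(i := a) = (h \<circ> v)(i := h a)" by auto
      have "wf_form L \<phi>" "range (v(i := a)) \<subseteq> universe M" using Ex.prems that by auto
      from Ex.IH[OF this] show ?thesis by (simp only: eq)
    qed
    then show ?case by (simp add: sur[symmetric] comp_def)
  }
qed

lemma sat_nth_isomorphism:
  assumes M: "is_struct L M" and h: "isomorphism L M N h" and "wf_form L \<phi>"
    "set xs \<subseteq> universe M" "free_vars \<phi> \<subseteq> {..<length xs}"
  shows "sat M (nth xs) \<phi> \<longleftrightarrow> sat N (nth (map h xs)) \<phi>"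
proof -
  obtain c where c: "c \<in> universe M" using M by (auto simp: is_struct_def)
  \<comment> \<open>\<open>nth xs\<close> is arbitrary beyond the list and may leave the universe
    there, whereas \<open>sat_isomorphism\<close> asks for a valuation into it; so pad with
    \<open>c\<close>.\<close>
  define v where "v i = (if i < length xs then xs ! i else c)" for i
  have "sat M (nth xs) \<phi> \<longleftrightarrow> sat M v \<phi>"
    by (rule sat_cong) (use assms in \<open>auto simp: v_def\<close>)
  also have "\<dots> \<longleftrightarrow> sat N (h \<circ> v) \<phi>"
    using assms c by (intro sat_isomorphism[OF M h]) (auto simp: v_def subset_iff)
  also have "\<dots> \<longleftrightarrow> sat N (nth (map h xs)) \<phi>"
    by (rule sat_cong) (use assms in \<open>auto simp: v_def\<close>)
  finally show ?thesis .
qed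

lemma is_model_isomorphism:
  assumes "is_model L T M" "T \<subseteq> sentences L" "isomorphism L M N h" "is_struct L N"
  shows "is_model L T N"
proof -
  have "sat N w \<phi>" if \<phi>: "\<phi> \<in> T" for \<phi> w
  proof -
    have s: "wf_form L \<phi>" "free_vars \<phi> = {}" using \<phi> assms(2) by (auto simp: sentences_def)
    have M: "is_struct L M" using assms(1) by (simp add: is_model_def)
    then obtain c where "c \<in> universe M" by (auto simp: is_struct_def)
    then have "sat M (\<lambda>_. c) \<phi>" using assms(1) \<phi> by (auto simp: is_model_def satisfies_def)
    then have "sat N (h \<circ> (\<lambda>_. c)) \<phi>"
      using sat_isomorphism[OF M assms(3) s(1), of "\<lambda>_. c"] \<open>c \<in> universe M\<close> by auto
    then show ?thesis using sat_cong[of \<phi> _ w N] s by auto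
  qed
  then show ?thesis using assms(4) by (auto simp: is_model_def satisfies_def)
qed

section \<open>Ultrapowers\<close>

text \<open>Being below \<open>sequentially\<close> means that all cofinite sets are events, that
  is, the ultrafilter is nonprincipal.\<close>

definition ultrafilter_on_nat :: "nat filter \<Rightarrow> bool" where
  "ultrafilter_on_nat U \<longleftrightarrow> U \<noteq> bot \<and> U \<le> sequentially \<and>
     (\<forall>P. eventually P U \<or> eventually (\<lambda>n. \<not> P n) U)"

lemma ex_ultrafilter_on_nat: "\<exists>U. ultrafilter_on_nat U"
proof -
  define A where "A = {F. F \<noteq> bot \<and> F \<le> (sequentially :: nat filter)}"
  \<comment> \<open>Smaller filters have more events, so Zorn is applied to the reversed order: a
    minimal proper filter below \<open>sequentially\<close> is sought.\<close>
  have "\<exists>m\<in>A. \<forall>a\<in>A. m \<ge> a \<longrightarrow> a = m"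
  proof (rule predicate_Zorn)
    show "partial_order_on A (relation_of (\<ge>) A)"
      by (rule partial_order_on_relation_ofI) auto
    fix C assume C: "C \<in> Chains (relation_of (\<ge>) A)"
    then have CA: "C \<subseteq> A" and ch: "\<And>F G. F \<in> C \<Longrightarrow> G \<in> C \<Longrightarrow> F \<le> G \<or> G \<le> F"
      by (auto simp: Chains_def relation_of_def)
    show "\<exists>u\<in>A. \<forall>a\<in>C. u \<le> a"
    proof (cases "C = {}")
      case True
      then show ?thesis by (auto simp: A_def intro!: exI[of _ sequentially])
    next
      case False
      \<comment> \<open>In a chain every event of the infimum is already one of some member, so
        proper filters cannot shrink to \<open>bot\<close>.\<close>
      have "eventually P (Inf C) \<longleftrightarrow> (\<exists>F\<in>C. eventually P F)" for P
      proof (rule eventually_Inf_base[OF False])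
        show "\<exists>H\<in>C. H \<le> inf F G" if "F \<in> C" "G \<in> C" for F G
          using ch[OF that] that by (auto simp: inf.absorb1 inf.absorb2 intro: bexI[of _ F] bexI[of _ G])
      qed
      then have "Inf C \<noteq> bot"
        using CA by (auto simp: trivial_limit_def A_def)
      moreover obtain F where "F \<in> C" using False by auto
      then have "Inf C \<le> sequentially" using CA by (auto simp: A_def intro: Inf_lower2)
      ultimately show ?thesis by (auto simp: A_def intro: Inf_lower)
    qed
  qed
  then obtain U where U: "U \<noteq> bot" "U \<le> sequentially"
    and max: "\<And>F. F \<noteq> bot \<Longrightarrow> F \<le> U \<Longrightarrow> F = U"
    unfolding A_def by (blast intro: order_trans)
  \<comment> \<open>Adding \<open>P\<close> as an event either collapses the filter, and then the
    complement is already an event, or changes nothing by minimality.\<close>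
  have "eventually P U \<or> eventually (\<lambda>n. \<not> P n) U" for P
  proof (cases "inf U (principal {n. P n}) = bot")
    case True
    then show ?thesis by (auto simp: trivial_limit_def eventually_inf_principal)
  next
    case False
    then have "inf U (principal {n. P n}) = U" by (intro max) auto
    moreover have "eventually P (inf U (principal {n. P n}))" by (simp add: eventually_inf_principal)
    ultimately show ?thesis by simp
  qed
  then show ?thesis using U by (auto simp: ultrafilter_on_nat_def)
qed

definition ultra_rep :: "nat filter \<Rightarrow> (nat \<Rightarrow> 'a) \<Rightarrow> nat \<Rightarrow> 'a" where
  "ultra_rep U f = (SOME g. eventually (\<lambda>n. f n = g n) U)"

text \<open>Elements of the ultrapower are chosen representatives of the classes modulo \<open>U\<close>.\<close>

definition ultrapower ::
    "nat filter \<Rightarrow> ('f, 'r, 'a) struct \<Rightarrow> ('f, 'r, nat \<Rightarrow> 'a) struct" where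
  "ultrapower U M =
     \<lparr>universe = ultra_rep U ` {f. range f \<subseteq> universe M},
      fun_of = (\<lambda>F xs. ultra_rep U (\<lambda>n. fun_of M F (map (\<lambda>x. x n) xs))),
      rel_of = (\<lambda>r xs. eventually (\<lambda>n. rel_of M r (map (\<lambda>x. x n) xs)) U)\<rparr>"

lemma ultra_rep_eventually: "eventually (\<lambda>n. ultra_rep U f n = f n) U"
proof -
  have "eventually (\<lambda>n. f n = ultra_rep U f n) U"
    unfolding ultra_rep_def by (rule someI[of _ f]) simp
  then show ?thesis by (simp add: eq_commute)
qed

text \<open>Congruent functions give the same choice predicate, so the same representative is
  picked; this replaces a quotient type.\<close>

lemma ultra_rep_cong: "eventually (\<lambda>n. f n = g n) U \<Longrightarrow> ultra_rep U f = ultra_rep U g"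
proof -
  assume *: "eventually (\<lambda>n. f n = g n) U"
  have "eventually (\<lambda>n. f n = h n) U \<longleftrightarrow> eventually (\<lambda>n. g n = h n) U" for h
    by (rule eventually_subst[OF eventually_mono[OF *]]) auto
  then show ?thesis by (simp add: ultra_rep_def)
qed

lemma range_ultra_rep_eq_iff:
  assumes "x \<in> range (ultra_rep U)" "y \<in> range (ultra_rep U)"
  shows "x = y \<longleftrightarrow> eventually (\<lambda>n. x n = y n) U"
proof
  assume *: "eventually (\<lambda>n. x n = y n) U"
  obtain f g where fg: "x = ultra_rep U f" "y = ultra_rep U g" using assms by auto
  have "eventually (\<lambda>n. f n = g n) U"
    using * ultra_rep_eventually[of U f] ultra_rep_eventually[of U g] unfolding fg
    by eventually_elim auto
  then show "x = y" by (simp add: fg ultra_rep_cong)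
qed simp

text \<open>A chosen representative may leave the universe of \<open>M\<close> on a set of indices
  that \<open>U\<close> ignores, so nothing stronger holds.\<close>

lemma ultrapower_universe_eventually:
  "x \<in> universe (ultrapower U M) \<Longrightarrow> eventually (\<lambda>n. x n \<in> universe M) U"
proof -
  assume "x \<in> universe (ultrapower U M)"
  then obtain f where f: "x = ultra_rep U f" "range f \<subseteq> universe M" by (auto simp: ultrapower_def)
  show ?thesis using ultra_rep_eventually[of U f] unfolding f(1)
    by eventually_elim (use f(2) in auto)
qed

lemma ultrapower_universeI:
  assumes "eventually (\<lambda>n. f n \<in> universe M) U" "universe M \<noteq> {}"
  shows "ultra_rep U f \<in> universe (ultrapower U M)"
proof -
  obtain c where c: "c \<in> universe M" using assms(2) by auto
  define g where "g n = (if f n \<in> universe M then f n else c)" for n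
  have "ultra_rep U f = ultra_rep U g"
    using assms(1) by (intro ultra_rep_cong) (auto elim: eventually_mono simp: g_def)
  moreover have "range g \<subseteq> universe M" using c by (auto simp: g_def)
  ultimately show ?thesis by (auto simp: ultrapower_def)
qed

lemma ultrapower_trm_val:
  "eventually (\<lambda>n. trm_val (ultrapower U M) v t n = trm_val M (\<lambda>i. v i n) t) U"
proof (induction t)
  case (App f ts)
  then have "eventually (\<lambda>n. \<forall>t\<in>set ts. trm_val (ultrapower U M) v t n = trm_val M (\<lambda>i. v i n) t) U"
    by (simp add: eventually_ball_finite)
  with ultra_rep_eventually[of U "\<lambda>n. fun_of M f (map (\<lambda>x. x n) (map (trm_val (ultrapower U M) v) ts))"]
  show ?case
  proof eventually_elim
    case (elim n)
    have "map (\<lambda>x. x n) (map (trm_val (ultrapower U M) v) ts) = map (trm_val M (\<lambda>i. v i n)) ts"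
      using elim by simp
    with elim(1) show ?case by (simp only: ultrapower_def trm_val.simps struct.simps)
  qed
qed simp

lemma map_ultrapower_trm_val:
  "eventually (\<lambda>n. map (\<lambda>x. x n) (map (trm_val (ultrapower U M) v) ts)
      = map (trm_val M (\<lambda>i. v i n)) ts) U"
proof -
  have "eventually (\<lambda>n. \<forall>t\<in>set ts. trm_val (ultrapower U M) v t n = trm_val M (\<lambda>i. v i n) t) U"
    by (simp add: eventually_ball_finite ultrapower_trm_val)
  then show ?thesis by eventually_elim simp
qed

text \<open>Maximality of \<open>U\<close> enters in the negation case. For \<open>Ex\<close>,
  witnesses are chosen index by index and assembled into one element.\<close>

theorem los:
  assumes U: "ultrafilter_on_nat U" and ne: "universe M \<noteq> {}"
  shows "range v \<subseteq> universe (ultrapower U M) \<Longrightarrow>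
    sat (ultrapower U M) v \<phi> \<longleftrightarrow> eventually (\<lambda>n. sat M (\<lambda>i. v i n) \<phi>) U"
proof (induction \<phi> arbitrary: v)
  let ?P = "ultrapower U M"
  have Uneg: "eventually (\<lambda>n. \<not> Q n) U \<longleftrightarrow> \<not> eventually Q U" for Q
    using U eventually_conj[of Q U "\<lambda>n. \<not> Q n"]
    by (auto simp: ultrafilter_on_nat_def trivial_limit_def)
  {
    case (Equal s t)
    \<comment> \<open>Values of compound terms are representatives by the definition of
      \<open>fun_of\<close>, so equality in the ultrapower is equality at almost every
      index.\<close>
    have "trm_val ?P v t \<in> range (ultra_rep U)" for t
      using Equal by (cases t) (auto simp: ultrapower_def subset_iff image_iff)
    then have "sat ?P v (Equal s t) \<longleftrightarrow> eventually (\<lambda>n. trm_val ?P v s n = trm_val ?P v t n) U"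
      by (simp add: range_ultra_rep_eq_iff)
    also have "\<dots> \<longleftrightarrow> eventually (\<lambda>n. trm_val M (\<lambda>i. v i n) s = trm_val M (\<lambda>i. v i n) t) U"
      by (rule eventually_subst) (use ultrapower_trm_val[of U M v s] ultrapower_trm_val[of U M v t]
          in \<open>auto elim: eventually_elim2\<close>)
    finally show ?case by simp
  next
    case (Rel r ts)
    have "sat ?P v (Rel r ts) \<longleftrightarrow>
        eventually (\<lambda>n. rel_of M r (map (\<lambda>x. x n) (map (trm_val ?P v) ts))) U"
      by (simp add: ultrapower_def)
    also have "\<dots> \<longleftrightarrow> eventually (\<lambda>n. rel_of M r (map (trm_val M (\<lambda>i. v i n)) ts)) U"
      by (rule eventually_subst[OF eventually_mono[OF map_ultrapower_trm_val[of U M v ts]]]) metis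
    finally show ?case by simp
  next
    case (Neg \<phi>)
    then show ?case by (simp add: Uneg)
  next
    case (Conj \<phi> \<psi>)
    then show ?case by (simp add: eventually_conj_iff)
  next
    case (Ex i \<phi>)
    have IH: "sat ?P (v(i := a)) \<phi> \<longleftrightarrow> eventually (\<lambda>n. sat M ((\<lambda>j. v j n)(i := a n)) \<phi>) U"
      if "a \<in> universe ?P" for a
    proof -
      have eq: "(\<lambda>j. (v(i := a)) j n) = (\<lambda>j. v j n)(i := a n)" for n by auto
      have "range (v(i := a)) \<subseteq> universe ?P" using Ex.prems that by auto
      from Ex.IH[OF this] show ?thesis by (simp only: eq)
    qed
    show ?case
    proof
      assume "sat ?P v (Ex i \<phi>)"
      then obtain a where a: "a \<in> universe ?P" "sat ?P (v(i := a)) \<phi>" by auto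
      from ultrapower_universe_eventually[OF a(1)] a(2)[unfolded IH[OF a(1)]]
      show "eventually (\<lambda>n. sat M (\<lambda>j. v j n) (Ex i \<phi>)) U"
        by eventually_elim auto
    next
      assume *: "eventually (\<lambda>n. sat M (\<lambda>j. v j n) (Ex i \<phi>)) U"
      then have "eventually (\<lambda>n. \<exists>a. a \<in> universe M \<and> sat M ((\<lambda>j. v j n)(i := a)) \<phi>) U"
        by eventually_elim auto
      then obtain a where a: "eventually (\<lambda>n. a n \<in> universe M \<and> sat M ((\<lambda>j. v j n)(i := a n)) \<phi>) U"
        by (auto simp: eventually_ex)
      then have u: "ultra_rep U a \<in> universe ?P"
        using ne by (intro ultrapower_universeI) (simp_all add: eventually_conj_iff)
      have "eventually (\<lambda>n. sat M ((\<lambda>j. v j n)(i := ultra_rep U a n)) \<phi>) U"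
        using a ultra_rep_eventually[of U a] by eventually_elim simp
      then show "sat ?P v (Ex i \<phi>)" using IH[OF u] u by auto
    qed
  }
qed

lemma is_model_ultrapower:
  assumes U: "ultrafilter_on_nat U" and M: "is_model L T M" and T: "T \<subseteq> sentences L"
  shows "is_model L T (ultrapower U M)"
proof -
  let ?P = "ultrapower U M"
  have ne: "universe M \<noteq> {}" and cl: "closed_under L M (universe M)"
    using M by (auto simp: is_model_def is_struct_def)
  have "fun_of ?P f xs \<in> universe ?P"
    if "f \<in> Funs L" "set xs \<subseteq> universe ?P" "length xs = fun_ar L f" for f xs
  proof -
    have "eventually (\<lambda>n. \<forall>x\<in>set xs. x n \<in> universe M) U"
      using that(2) by (intro eventually_ball_finite) (auto simp: ultrapower_universe_eventually)
    then have "eventually (\<lambda>n. fun_of M f (map (\<lambda>x. x n) xs) \<in> universe M) U"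
    proof eventually_elim
      case (elim n)
      then have "set (map (\<lambda>x. x n) xs) \<subseteq> universe M" by auto
      then show ?case using cl that unfolding closed_under_def by (metis length_map)
    qed
    from ultrapower_universeI[OF this ne] show ?thesis by (simp add: ultrapower_def)
  qed
  then have s: "is_struct L ?P"
    using ultrapower_universeI[of "\<lambda>_. SOME c. c \<in> universe M" M U] ne
    by (auto simp: is_struct_def closed_under_def some_in_eq)
  moreover have "sat ?P v \<phi>" if "\<phi> \<in> T" "range v \<subseteq> universe ?P" for v \<phi>
  proof -
    obtain c where c: "c \<in> universe M" using ne by auto
    \<comment> \<open>The coordinates \<open>v i n\<close> may leave the universe of
      \<open>M\<close>; as \<open>\<phi>\<close> is a sentence, a constant valuation inside the
      universe decides it.\<close>
    have "sat M (\<lambda>i. v i n) \<phi>" for n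
    proof -
      have "sat M (\<lambda>_. c) \<phi>" using M that(1) c by (auto simp: is_model_def satisfies_def)
      moreover have "free_vars \<phi> = {}" using T that(1) by (auto simp: sentences_def)
      ultimately show ?thesis using sat_cong[of \<phi> "\<lambda>i. v i n" "\<lambda>_. c" M] by auto
    qed
    then show ?thesis using los[OF U ne that(2)] by simp
  qed
  ultimately show ?thesis by (auto simp: is_model_def satisfies_def)
qed

section \<open>Loewenheim-Skolem and compactness\<close>

lemma UN_lepoll:
  assumes "infinite U" "I \<lesssim> U" "\<And>i. i \<in> I \<Longrightarrow> A i \<lesssim> U"
  shows "(\<Union>i\<in>I. A i) \<lesssim> U"
  using card_of_UNION_ordLeq_infinite[of U I A] assms
  unfolding lepoll_def card_of_ordLeq by blast

lemma times_lepoll: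
  assumes "infinite U" "A \<lesssim> U" "B \<lesssim> U"
  shows "A \<times> B \<lesssim> U"
  using card_of_Sigma_ordLeq_infinite[of U A "\<lambda>_. B"] assms
  unfolding lepoll_def card_of_ordLeq by blast

lemma Un_lepoll:
  assumes "infinite U" "A \<lesssim> U" "B \<lesssim> U"
  shows "A \<union> B \<lesssim> U"
proof -
  have "(\<Union>i\<in>{True, False}. if i then A else B) \<lesssim> U"
  proof (rule UN_lepoll[OF assms(1)])
    show "{True, False} \<lesssim> U" by (rule finite_lepoll_infinite[OF assms(1)]) simp
  qed (use assms in auto)
  then show ?thesis by (simp add: Un_commute)
qed

lemma countable_lepoll_infinite:
  assumes "infinite U" "countable A"
  shows "A \<lesssim> U"
proof -
  have "A \<lesssim> (UNIV :: nat set)" using assms(2) by (auto simp: countable_def lepoll_def)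
  then show ?thesis using assms(1) lepoll_trans by (auto simp: infinite_le_lepoll)
qed

lemma lists_lepoll:
  assumes U: "infinite U" and A: "A \<lesssim> U"
  shows "lists A \<lesssim> U"
proof -
  have n: "{xs. set xs \<subseteq> A \<and> length xs = n} \<lesssim> U" for n
  proof (induction n)
    case 0
    have "{xs. set xs \<subseteq> A \<and> length xs = 0} = {[]}" by auto
    then show ?case using U by (simp add: finite_lepoll_infinite)
  next
    case (Suc n)
    have "{xs. set xs \<subseteq> A \<and> length xs = Suc n} =
        (\<lambda>(x, xs). x # xs) ` (A \<times> {xs. set xs \<subseteq> A \<and> length xs = n})"
      by (auto simp: length_Suc_conv image_iff)
    then have "{xs. set xs \<subseteq> A \<and> length xs = Suc n} \<lesssim> A \<times> {xs. set xs \<subseteq> A \<and> length xs = n}"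
      by (simp only: image_lepoll)
    also have "\<dots> \<lesssim> U" by (rule times_lepoll[OF U A Suc])
    finally show ?case .
  qed
  have "lists A = (\<Union>n. {xs. set xs \<subseteq> A \<and> length xs = n})" by (auto simp: lists_eq_set)
  moreover have "(\<Union>n. {xs. set xs \<subseteq> A \<and> length xs = n}) \<lesssim> U"
    by (rule UN_lepoll[OF U countable_lepoll_infinite[OF U] n]) simp
  ultimately show ?thesis by simp
qed

text \<open>Operations act on lists of any length, so one statement serves terms, formulas and
  Skolem hulls. Arguments are finite, so countably many rounds suffice, and each round keeps the
  size at most that of \<open>U\<close>.\<close>

lemma ex_small_closure:
  assumes U: "infinite U" and I: "I \<lesssim> U" and B: "B \<lesssim> U"
  shows "\<exists>H. B \<subseteq> H \<and> H \<lesssim> U \<and> (\<forall>i\<in>I. \<forall>xs\<in>lists H. g i xs \<in> H)"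
proof -
  define step where "step X = X \<union> (\<lambda>(i, xs). g i xs) ` (I \<times> lists X)" for X
  define S where "S n = (step ^^ n) B" for n
  have S: "S n \<lesssim> U" for n
  proof (induction n)
    case (Suc n)
    have "(\<lambda>(i, xs). g i xs) ` (I \<times> lists (S n)) \<lesssim> I \<times> lists (S n)" by (rule image_lepoll)
    also have "\<dots> \<lesssim> U" by (intro times_lepoll I lists_lepoll U Suc)
    finally show ?case using Un_lepoll[OF U Suc] by (simp add: S_def step_def)
  qed (use B in \<open>simp add: S_def\<close>)
  have "S n \<subseteq> S (Suc n)" for n by (auto simp: S_def step_def)
  then have mono: "m \<le> n \<Longrightarrow> S m \<subseteq> S n" for m n by (rule lift_Suc_mono_le)
  define H where "H = (\<Union>n. S n)"
  have "g i xs \<in> H" if "i \<in> I" "xs \<in> lists H" for i xs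
  proof -
    have "\<exists>n. set xs \<subseteq> S n"
      using that(2)
    proof (induction xs)
      case (Cons x xs)
      then obtain m n where "x \<in> S m" "set xs \<subseteq> S n" by (auto simp: H_def)
      then have "set (x # xs) \<subseteq> S (max m n)"
        using mono[of m "max m n"] mono[of n "max m n"] by auto
      then show ?case ..
    qed simp
    then obtain n where "xs \<in> lists (S n)" by auto
    then have "g i xs \<in> S (Suc n)" using that(1) by (force simp: S_def step_def)
    then show ?thesis by (auto simp: H_def)
  qed
  moreover have "B \<subseteq> H" using UN_upper[of 0 UNIV S] by (simp add: H_def S_def)
  moreover have "H \<lesssim> U"
    unfolding H_def by (rule UN_lepoll[OF U countable_lepoll_infinite[OF U] S]) simp
  ultimately show ?thesis by blast
qed

lemma wf_forms_lepoll:
  fixes L :: "('f, 'r) language"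
  assumes "large_type TYPE('u) L"
  shows "{\<phi>. wf_form L \<phi>} \<lesssim> (UNIV :: 'u set)"
proof -
  let ?U = "UNIV :: 'u set"
  have U: "infinite ?U" and F: "Funs L \<lesssim> ?U" and R: "Rels L \<lesssim> ?U"
    using assms by (auto simp: large_type_def)
  have "range Var \<lesssim> ?U" by (rule countable_lepoll_infinite[OF U]) simp
  from ex_small_closure[OF U F this, of App]
  obtain W where W: "range Var \<subseteq> W" "W \<lesssim> ?U" "\<forall>f\<in>Funs L. \<forall>ts\<in>lists W. App f ts \<in> W" by auto
  have wfW: "wf_trm L t \<Longrightarrow> t \<in> W" for t
  proof (induction t)
    case (App f ts)
    then have "f \<in> Funs L" "ts \<in> lists W" by auto
    then show ?case using W by blast
  qed (use W in auto)
  let ?B = "(\<lambda>(s, t). Equal s t) ` (W \<times> W) \<union> (\<lambda>(r, ts). Rel r ts) ` (Rels L \<times> lists W)"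
  have "(\<lambda>(s, t). Equal s t) ` (W \<times> W) \<lesssim> ?U"
    by (rule lepoll_trans[OF image_lepoll times_lepoll]) (use U W in auto)
  moreover have "(\<lambda>(r, ts). Rel r ts) ` (Rels L \<times> lists W) \<lesssim> ?U"
    by (rule lepoll_trans[OF image_lepoll times_lepoll]) (use U R lists_lepoll[OF U] W in auto)
  ultimately have B: "?B \<lesssim> ?U" by (rule Un_lepoll[OF U])
  \<comment> \<open>The countable type \<open>nat option option\<close> names negation, conjunction
    and \<open>Ex i\<close> for every \<open>i\<close>. Values on lists of the wrong length are
    harmless, since \<open>H\<close> need only contain all formulas.\<close>
  define g where "g c \<phi>s = (case c of None \<Rightarrow> Neg (hd \<phi>s) | Some None \<Rightarrow> Conj (hd \<phi>s) (hd (tl \<phi>s))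
      | Some (Some i) \<Rightarrow> Ex i (hd \<phi>s))" for c and \<phi>s :: "('f, 'r) form list"
  have "(UNIV :: nat option option set) \<lesssim> ?U" by (rule countable_lepoll_infinite[OF U]) simp
  from ex_small_closure[OF U this B, of g]
  obtain H where H: "?B \<subseteq> H" "H \<lesssim> ?U" and g: "\<And>c \<phi>s. \<phi>s \<in> lists H \<Longrightarrow> g c \<phi>s \<in> H" by blast
  have "wf_form L \<phi> \<Longrightarrow> \<phi> \<in> H" for \<phi>
  proof (induction \<phi>)
    case (Equal s t)
    then have "Equal s t \<in> ?B" using wfW by auto
    then show ?case using H by blast
  next
    case (Rel r ts)
    then have "Rel r ts \<in> ?B" using wfW by auto
    then show ?case using H by blast
  next
    case (Neg \<phi>)
    then show ?case using g[of "[\<phi>]" None] by (simp add: g_def)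
  next
    case (Conj \<phi> \<psi>)
    then show ?case using g[of "[\<phi>, \<psi>]" "Some None"] by (simp add: g_def)
  next
    case (Ex i \<phi>)
    then show ?case using g[of "[\<phi>]" "Some (Some i)"] by (simp add: g_def)
  qed
  then have "{\<phi>. wf_form L \<phi>} \<subseteq> H" by auto
  then show ?thesis using H(2) lepoll_trans[OF subset_imp_lepoll] by blast
qed

section \<open>Elementary substructures and their copies in the given type\<close>

lemma trm_val_universe [simp]: "trm_val (M\<lparr>universe := H\<rparr>) v t = trm_val M v t"
proof (induction t)
  case (App f ts)
  then have "map (trm_val (M\<lparr>universe := H\<rparr>) v) ts = map (trm_val M v) ts" by simp
  then show ?case by (simp del: map_eq_conv)
qed simp

text \<open>Witnesses are required for finite lists of parameters instead of valuations: there are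
  no more lists than elements of an infinite \<open>H\<close>, but there may be too many functions
  from the naturals to \<open>H\<close>.\<close>

lemma tarski_vaught:
  assumes H: "H \<subseteq> universe M"
    and wit: "\<And>\<phi> i xs a. wf_form L \<phi> \<Longrightarrow> set xs \<subseteq> H \<Longrightarrow> a \<in> universe M \<Longrightarrow>
      sat M ((nth xs)(i := a)) \<phi> \<Longrightarrow> \<exists>b\<in>H. sat M ((nth xs)(i := b)) \<phi>"
  shows "wf_form L \<phi> \<Longrightarrow> range v \<subseteq> H \<Longrightarrow> sat (M\<lparr>universe := H\<rparr>) v \<phi> \<longleftrightarrow> sat M v \<phi>"
proof (induction \<phi> arbitrary: v)
  case (Rel r ts)
  have "map (trm_val (M\<lparr>universe := H\<rparr>) v) ts = map (trm_val M v) ts" by simp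
  then show ?case by (simp del: map_eq_conv)
next
  case (Ex i \<phi>)
  have IH: "sat (M\<lparr>universe := H\<rparr>) (v(i := b)) \<phi> \<longleftrightarrow> sat M (v(i := b)) \<phi>" if "b \<in> H" for b
    by (rule Ex.IH) (use Ex.prems that in auto)
  have "\<exists>b\<in>H. sat M (v(i := b)) \<phi>" if a: "a \<in> universe M" "sat M (v(i := a)) \<phi>" for a
  proof -
    obtain K where K: "free_vars \<phi> \<subseteq> {..<K}"
      using finite_nat_bounded[OF finite_free_vars] by auto
    \<comment> \<open>\<open>\<phi>\<close> sees only the first \<open>K\<close> values of the
      valuation, so a finite list stands for it.\<close>
    define xs where "xs = map v [0..<K]"
    have eq: "sat M ((nth xs)(i := b)) \<phi> \<longleftrightarrow> sat M (v(i := b)) \<phi>" for b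
      by (rule sat_cong) (use K in \<open>auto simp: xs_def subset_iff\<close>)
    have "set xs \<subseteq> H" using Ex.prems by (auto simp: xs_def)
    then show ?thesis using wit[of \<phi> xs a i] Ex.prems a by (auto simp: eq)
  qed
  then show ?case using IH H by auto
qed auto

text \<open>The new model is a Skolem hull of \<open>B\<close>, copied along an injection
  \<open>h\<close>. Truth is tracked for tuples from \<open>B\<close>, which is all that the coding
  needs.\<close>

theorem loewenheim_skolem:
  fixes M :: "('f, 'r, 'a) struct"
  assumes M: "is_model L T M" and T: "T \<subseteq> sentences L" and large: "large_type TYPE('u) L"
    and B: "B \<subseteq> universe M" "countable B"
  obtains N :: "('f, 'r, 'u) struct" and h where "is_model L T N" "h ` B \<subseteq> universe N"
    "\<And>\<phi> xs. wf_form L \<phi> \<Longrightarrow> set xs \<subseteq> B \<Longrightarrow> free_vars \<phi> \<subseteq> {..<length xs} \<Longrightarrow>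
       sat N (nth (map h xs)) \<phi> \<longleftrightarrow> sat M (nth xs) \<phi>"
proof -
  let ?U = "UNIV :: 'u set"
  have U: "infinite ?U" and F: "Funs L \<lesssim> ?U" using large by (auto simp: large_type_def)
  have cl: "closed_under L M (universe M)" using M by (auto simp: is_model_def is_struct_def)
  obtain c where c: "c \<in> universe M" using M by (auto simp: is_model_def is_struct_def)
  define wit where "wit \<phi> i xs = (if \<exists>a\<in>universe M. sat M ((nth xs)(i := a)) \<phi>
    then SOME a. a \<in> universe M \<and> sat M ((nth xs)(i := a)) \<phi> else c)"
    for \<phi> :: "('f, 'r) form" and i xs
  have wit: "wit \<phi> i xs \<in> universe M"
    "a \<in> universe M \<Longrightarrow> sat M ((nth xs)(i := a)) \<phi> \<Longrightarrow> sat M ((nth xs)(i := wit \<phi> i xs)) \<phi>" for \<phi> i xs a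
    using someI_ex[of "\<lambda>a. a \<in> universe M \<and> sat M ((nth xs)(i := a)) \<phi>"] c
    by (auto simp: wit_def)
  \<comment> \<open>Skolem functions and function symbols form one family. Falling back to
    \<open>c\<close> keeps all values in the universe, also on lists where \<open>fun_of\<close> is
    junk.\<close>
  define g where "g s xs = (case s of Inl (\<phi>, i) \<Rightarrow> wit \<phi> i xs
      | Inr f \<Rightarrow> if fun_of M f xs \<in> universe M then fun_of M f xs else c)" for s xs
  let ?I = "Inl ` ({\<phi>. wf_form L \<phi>} \<times> (UNIV :: nat set)) \<union> Inr ` Funs L"
  have "?I \<lesssim> ?U"
  proof (rule Un_lepoll[OF U])
    show "Inl ` ({\<phi>. wf_form L \<phi>} \<times> (UNIV :: nat set)) \<lesssim> ?U"
      by (rule lepoll_trans[OF image_lepoll times_lepoll[OF U wf_forms_lepoll[OF large]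
            countable_lepoll_infinite[OF U]]]) simp
  qed (rule lepoll_trans[OF image_lepoll F])
  moreover have "insert c B \<lesssim> ?U" by (rule countable_lepoll_infinite[OF U]) (use B in simp)
  ultimately obtain H' where H': "insert c B \<subseteq> H'" "H' \<lesssim> ?U" "\<forall>s\<in>?I. \<forall>xs\<in>lists H'. g s xs \<in> H'"
    using ex_small_closure[OF U, of ?I "insert c B" g] by blast
  \<comment> \<open>The closed set \<open>H'\<close> may contain stray elements; as \<open>g\<close>
    takes values in the universe, the intersection is still closed.\<close>
  define H where "H = H' \<inter> universe M"
  have HB: "insert c B \<subseteq> H" using H' B c by (auto simp: H_def)
  have "H \<lesssim> H'" unfolding H_def by (rule subset_imp_lepoll) auto
  then have "H \<lesssim> ?U" using H'(2) by (rule lepoll_trans)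
  have g: "g s xs \<in> H" if "s \<in> ?I" "set xs \<subseteq> H" for s xs
  proof -
    have "g s xs \<in> universe M" using wit(1) c by (auto simp: g_def split: sum.splits)
    moreover have "g s xs \<in> H'" using H'(3) that by (auto simp: H_def)
    ultimately show ?thesis by (simp add: H_def)
  qed
  let ?S = "M\<lparr>universe := H\<rparr>"
  have el: "sat ?S v \<phi> \<longleftrightarrow> sat M v \<phi>" if "wf_form L \<phi>" "range v \<subseteq> H" for v \<phi>
  proof (rule tarski_vaught[OF _ _ that])
    show "\<exists>b\<in>H. sat M ((nth xs)(i := b)) \<psi>"
      if "wf_form L \<psi>" "set xs \<subseteq> H" "a \<in> universe M" "sat M ((nth xs)(i := a)) \<psi>" for \<psi> i xs a
      using g[of "Inl (\<psi>, i)" xs] wit(2)[of a xs i \<psi>] that by (auto simp: g_def)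
  qed (auto simp: H_def)
  have "closed_under L ?S H"
    unfolding closed_under_def
  proof (intro ballI allI impI)
    fix f xs assume *: "f \<in> Funs L" "set xs \<subseteq> H \<and> length xs = fun_ar L f"
    then have "fun_of M f xs \<in> universe M" using cl by (auto simp: closed_under_def H_def)
    then show "fun_of ?S f xs \<in> H" using g[of "Inr f" xs] * by (simp add: g_def)
  qed
  then have Ss: "is_struct L ?S" using HB by (auto simp: is_struct_def closed_under_def)
  have Sm: "is_model L T ?S"
    using M T Ss el by (auto simp: is_model_def satisfies_def sentences_def H_def subset_iff)
  obtain h :: "'a \<Rightarrow> 'u" where h: "inj_on h H" using \<open>H \<lesssim> ?U\<close> by (auto simp: lepoll_def)
  let ?k = "inv_into H h"
  define N where "N = \<lparr>universe = h ` H, fun_of = (\<lambda>f xs. h (fun_of M f (map ?k xs))),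
    rel_of = (\<lambda>r xs. rel_of M r (map ?k xs))\<rparr>"
  have kh: "map (?k \<circ> h) xs = xs" if "set xs \<subseteq> H" for xs
    using h that by (intro map_idI) (auto simp: subset_iff)
  have iso: "isomorphism L ?S N h"
    using h kh by (auto simp: isomorphism_def embedding_def N_def tuples_def)
  have "is_struct L N"
    unfolding is_struct_def closed_under_def
  proof (intro conjI ballI allI impI)
    show "universe N \<noteq> {}" using HB by (auto simp: N_def)
    fix f xs assume "f \<in> Funs L" "set xs \<subseteq> universe N \<and> length xs = fun_ar L f"
    moreover from this have "set (map ?k xs) \<subseteq> H"
      by (auto simp: N_def subset_iff intro!: inv_into_into)
    ultimately have "fun_of M f (map ?k xs) \<in> H"
      using Ss by (simp add: is_struct_def closed_under_def)
    then show "fun_of N f xs \<in> universe N" by (simp add: N_def)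
  qed
  then have "is_model L T N" using is_model_isomorphism[OF Sm T iso] by simp
  moreover have "h ` B \<subseteq> universe N" using HB by (auto simp: N_def)
  moreover have "sat N (nth (map h xs)) \<phi> \<longleftrightarrow> sat M (nth xs) \<phi>"
    if *: "wf_form L \<phi>" "set xs \<subseteq> B" "free_vars \<phi> \<subseteq> {..<length xs}" for \<phi> xs
  proof -
    define v where "v i = (if i < length xs then xs ! i else c)" for i
    have v: "\<And>i. i \<in> free_vars \<phi> \<Longrightarrow> nth xs i = v i" using * by (auto simp: v_def)
    have "range v \<subseteq> H" using * HB by (auto simp: v_def subset_iff)
    then have "sat ?S (nth xs) \<phi> \<longleftrightarrow> sat M (nth xs) \<phi>"
      using el[OF *(1)] sat_cong[OF v, where M = ?S] sat_cong[OF v, where M = M] by simp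
    then show ?thesis using sat_nth_isomorphism[OF Ss iso *(1), of xs] * HB by auto
  qed
  ultimately show ?thesis by (rule that)
qed

text \<open>At index \<open>n\<close> take a realization of the pattern on \<open>{..<n}\<close> and
  glue these tuples over all \<open>n\<close>. A fixed pair \<open>i\<close>, \<open>j\<close> lies
  below almost every \<open>n\<close>, so by \<open>los\<close> the glued tuples realize the whole
  pattern.\<close>

theorem ex_model_coding:
  fixes M :: "('f, 'r, 'u) struct"
  assumes T: "T \<subseteq> sentences L" and large: "large_type TYPE('u) L" and M: "is_model L T M"
    and \<phi>: "wf_form L \<phi>" "free_vars \<phi> \<subseteq> {..<k + l}"
    and fin: "\<And>n :: nat. \<exists>a b. (\<forall>i<n. a i \<in> tuples k (universe M) \<and> b i \<in> tuples l (universe M)) \<and>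
      (\<forall>i<n. \<forall>j<n. sat M (nth (a i @ b j)) \<phi> \<longleftrightarrow> S i j)"
  obtains N :: "('f, 'r, 'u) struct" and a b where "is_model L T N"
    "\<And>i :: nat. a i \<in> tuples k (universe N)" "\<And>i. b i \<in> tuples l (universe N)"
    "\<And>i j. sat N (nth (a i @ b j)) \<phi> \<longleftrightarrow> S i j"
proof -
  obtain U where U: "ultrafilter_on_nat U" using ex_ultrafilter_on_nat ..
  let ?P = "ultrapower U M"
  have ne: "universe M \<noteq> {}" using M by (auto simp: is_model_def is_struct_def)
  then obtain c where c: "c \<in> universe M" by auto
  obtain a b where ab: "\<And>n i. i < n \<Longrightarrow> a n i \<in> tuples k (universe M)"
    "\<And>n i. i < n \<Longrightarrow> b n i \<in> tuples l (universe M)"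
    "\<And>n i j. i < n \<Longrightarrow> j < n \<Longrightarrow> sat M (nth (a n i @ b n j)) \<phi> \<longleftrightarrow> S i j"
    using fin by metis
  \<comment> \<open>This is where nonprincipality enters: only finitely many indices fail to reach
    beyond \<open>m\<close>.\<close>
  have late: "eventually (\<lambda>n. m < n) U" for m
    using U eventually_gt_at_top[of m] by (auto simp: ultrafilter_on_nat_def le_filter_def)
  \<comment> \<open>Glues a sequence of tuples into one tuple over the ultrapower, entry by
    entry.\<close>
  define up where "up m f = map (\<lambda>j. ultra_rep U (\<lambda>n. f n ! j)) [0..<m]" for m and f :: "nat \<Rightarrow> 'u list"
  have up: "up m f \<in> tuples m (universe ?P)"
    if ev: "eventually (\<lambda>n. f n \<in> tuples m (universe M)) U" for f m
  proof -
    have "ultra_rep U (\<lambda>n. f n ! j) \<in> universe ?P" if j: "j < m" for j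
      by (rule ultrapower_universeI[OF eventually_mono[OF ev] ne]) (use j in \<open>auto simp: tuples_def subset_iff\<close>)
    then show ?thesis by (auto simp: up_def tuples_def)
  qed
  have satP: "sat ?P (nth (up k f @ up l g)) \<phi> \<longleftrightarrow> eventually (\<lambda>n. sat M (nth (f n @ g n)) \<phi>) U"
    if f: "eventually (\<lambda>n. f n \<in> tuples k (universe M)) U"
      and g: "eventually (\<lambda>n. g n \<in> tuples l (universe M)) U" for f g
  proof -
    define d where "d = ultra_rep U (\<lambda>_. c)"
    have d: "d \<in> universe ?P" unfolding d_def by (rule ultrapower_universeI) (use c in auto)
    define v where "v i = (if i < k + l then (up k f @ up l g) ! i else d)" for i
    have "sat ?P (nth (up k f @ up l g)) \<phi> \<longleftrightarrow> sat ?P v \<phi>"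
      by (rule sat_cong) (use \<phi> in \<open>auto simp: v_def\<close>)
    also have "range v \<subseteq> universe ?P"
      using up[OF f] up[OF g] d by (auto simp: v_def tuples_def nth_append subset_iff)
    then have "sat ?P v \<phi> \<longleftrightarrow> eventually (\<lambda>n. sat M (\<lambda>i. v i n) \<phi>) U"
      by (rule los[OF U ne])
    also have "\<dots> \<longleftrightarrow> eventually (\<lambda>n. sat M (nth (f n @ g n)) \<phi>) U"
    proof (rule eventually_subst)
      have "eventually (\<lambda>n. \<forall>j\<in>{..<k}. ultra_rep U (\<lambda>n. f n ! j) n = f n ! j) U"
        "eventually (\<lambda>n. \<forall>j\<in>{..<l}. ultra_rep U (\<lambda>n. g n ! j) n = g n ! j) U"
        by (intro eventually_ball_finite ballI ultra_rep_eventually; simp)+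
      with f g show "eventually (\<lambda>n. sat M (\<lambda>i. v i n) \<phi> \<longleftrightarrow> sat M (nth (f n @ g n)) \<phi>) U"
      proof eventually_elim
        case (elim n)
        have "v i n = (f n @ g n) ! i" if "i < k + l" for i
          using elim that by (auto simp: v_def up_def tuples_def nth_append)
        then show ?case using \<phi>(2) by (intro sat_cong) auto
      qed
    qed
    finally show ?thesis .
  qed
  define a' b' where "a' i = up k (\<lambda>n. a n i)" and "b' i = up l (\<lambda>n. b n i)" for i
  have eva: "eventually (\<lambda>n. a n i \<in> tuples k (universe M)) U" for i
    by (rule eventually_mono[OF late[of i]]) (rule ab)
  have evb: "eventually (\<lambda>n. b n i \<in> tuples l (universe M)) U" for i
    by (rule eventually_mono[OF late[of i]]) (rule ab)
  have a': "a' i \<in> tuples k (universe ?P)" and b': "b' i \<in> tuples l (universe ?P)" for i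
    unfolding a'_def b'_def by (rule up, rule eva evb)+
  have S: "sat ?P (nth (a' i @ b' j)) \<phi> \<longleftrightarrow> S i j" for i j
  proof -
    have "eventually (\<lambda>n. sat M (nth (a n i @ b n j)) \<phi> \<longleftrightarrow> S i j) U"
      using late[of i] late[of j] by eventually_elim (rule ab)
    then have "eventually (\<lambda>n. sat M (nth (a n i @ b n j)) \<phi>) U \<longleftrightarrow> eventually (\<lambda>_. S i j) U"
      by (rule eventually_subst)
    then show ?thesis
      using satP[OF eva evb] U by (cases "S i j") (auto simp: a'_def b'_def ultrafilter_on_nat_def trivial_limit_def)
  qed
  let ?B = "\<Union>i. set (a' i) \<union> set (b' i)"
  have PB: "?B \<subseteq> universe ?P" using a' b' by (auto simp: tuples_def)
  have "countable ?B" by (simp add: countable_finite)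
  then obtain N :: "('f, 'r, 'u) struct" and h where N: "is_model L T N" "h ` ?B \<subseteq> universe N"
    "\<And>\<phi> xs. wf_form L \<phi> \<Longrightarrow> set xs \<subseteq> ?B \<Longrightarrow> free_vars \<phi> \<subseteq> {..<length xs} \<Longrightarrow>
       sat N (nth (map h xs)) \<phi> \<longleftrightarrow> sat ?P (nth xs) \<phi>"
    using loewenheim_skolem[OF is_model_ultrapower[OF U M T] T large PB] by blast
  have "sat N (nth (map h (a' i) @ map h (b' j))) \<phi> \<longleftrightarrow> S i j" for i j
    using N(3)[of \<phi> "a' i @ b' j"] S[of i j] \<phi> a'[of i] b'[of j] by (auto simp: tuples_def)
  moreover have "map h (a' i) \<in> tuples k (universe N)" "map h (b' i) \<in> tuples l (universe N)" for i
    using a'[of i] b'[of i] N(2) by (auto simp: tuples_def)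
  ultimately show ?thesis using that[of N "\<lambda>i. map h (a' i)" "\<lambda>i. map h (b' i)"] N(1) by blast
qed

section \<open>Definable sets\<close>

fun rename_trm :: "(nat \<Rightarrow> nat) \<Rightarrow> 'f trm \<Rightarrow> 'f trm" where
  "rename_trm \<rho> (Var i) = Var (\<rho> i)"
| "rename_trm \<rho> (App f ts) = App f (map (rename_trm \<rho>) ts)"

text \<open>Bound variables are moved to fresh ones, so that \<open>\<rho>\<close> need not be injective.\<close>

fun rename :: "(nat \<Rightarrow> nat) \<Rightarrow> ('f, 'r) form \<Rightarrow> ('f, 'r) form" where
  "rename \<rho> (Equal s t) = Equal (rename_trm \<rho> s) (rename_trm \<rho> t)"
| "rename \<rho> (Rel r ts) = Rel r (map (rename_trm \<rho>) ts)"
| "rename \<rho> (Neg \<phi>) = Neg (rename \<rho> \<phi>)"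
| "rename \<rho> (Conj \<phi> \<psi>) = Conj (rename \<rho> \<phi>) (rename \<rho> \<psi>)"
| "rename \<rho> (Ex i \<phi>) =
     (let k = Suc (Max (insert 0 (\<rho> ` free_vars (Ex i \<phi>)))) in Ex k (rename (\<rho>(i := k)) \<phi>))"

lemma wf_rename_trm: "wf_trm L t \<Longrightarrow> wf_trm L (rename_trm \<rho> t)"
  by (induction t) auto

lemma wf_rename: "wf_form L \<phi> \<Longrightarrow> wf_form L (rename \<rho> \<phi>)"
  by (induction \<phi> arbitrary: \<rho>) (auto simp: wf_rename_trm Let_def)

lemma trm_vars_rename_trm: "trm_vars (rename_trm \<rho> t) = \<rho> ` trm_vars t"
  by (induction t) auto

lemma free_vars_rename: "free_vars (rename \<rho> \<phi>) \<subseteq> \<rho> ` free_vars \<phi>"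
proof (induction \<phi> arbitrary: \<rho>)
  case (Ex i \<phi>)
  show ?case unfolding rename.simps Let_def free_vars.simps
    by (rule subset_trans[OF Diff_mono[OF Ex.IH subset_refl]]) auto
next
  case (Conj \<phi> \<psi>)
  then show ?case by (simp add: image_Un) (meson le_supI1 le_supI2)
qed (auto simp: trm_vars_rename_trm)

lemma trm_val_rename_trm: "trm_val M v (rename_trm \<rho> t) = trm_val M (\<lambda>i. v (\<rho> i)) t"
proof (induction t)
  case (App f ts)
  then have "map (trm_val M v) (map (rename_trm \<rho>) ts) = map (trm_val M (\<lambda>i. v (\<rho> i))) ts" by simp
  then show ?case by (simp del: map_eq_conv map_map)
qed simp

lemma sat_rename: "sat M v (rename \<rho> \<phi>) \<longleftrightarrow> sat M (\<lambda>i. v (\<rho> i)) \<phi>"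
proof (induction \<phi> arbitrary: v \<rho>)
  case (Equal s t)
  then show ?case by (simp add: trm_val_rename_trm)
next
  case (Rel r ts)
  have "map (trm_val M v) (map (rename_trm \<rho>) ts) = map (trm_val M (\<lambda>i. v (\<rho> i))) ts"
    by (simp add: trm_val_rename_trm)
  then show ?case by (simp del: map_eq_conv map_map)
next
  case (Ex i \<phi>)
  define k where "k = Suc (Max (insert 0 (\<rho> ` free_vars (Ex i \<phi>))))"
  have fresh: "\<rho> j \<noteq> k" if "j \<in> free_vars (Ex i \<phi>)" for j
  proof -
    have "\<rho> j \<le> Max (insert 0 (\<rho> ` free_vars (Ex i \<phi>)))"
      by (rule Max_ge) (use that in auto)
    then show ?thesis by (simp add: k_def)
  qed
  have "sat M (v(k := a)) (rename (\<rho>(i := k)) \<phi>) \<longleftrightarrow> sat M ((\<lambda>j. v (\<rho> j))(i := a)) \<phi>" for a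
    unfolding Ex.IH by (rule sat_cong) (use fresh in auto)
  then show ?case by (simp add: k_def Let_def)
next
  case (Neg \<phi>)
  show ?case by (simp add: Neg.IH)
next
  case (Conj \<phi> \<psi>)
  show ?case by (simp add: Conj.IH)
qed

section \<open>Closure properties of definable sets\<close>

lemma definable_subset: "definable L N m X \<Longrightarrow> X \<subseteq> tuples m (universe N)"
  by (auto simp: definable_def)

lemma definable_tuples:
  assumes "universe N \<noteq> {}"
  shows "definable L N m (tuples m (universe N))"
proof -
  \<comment> \<open>\<open>Equal (Var 0) (Var 0)\<close> serves as truth; the parameter
    \<open>c\<close> keeps variable 0 within the bound when \<open>m = 0\<close>.\<close>
  obtain c where "c \<in> universe N" using assms by auto
  then show ?thesis unfolding definable_def
    by (intro exI[of _ "Equal (Var 0) (Var 0)"] exI[of _ "[c]"]) auto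
qed

lemma definable_Diff:
  assumes "definable L N m X"
  shows "definable L N m (tuples m (universe N) - X)"
proof -
  obtain \<phi> ps where "wf_form L \<phi>" "set ps \<subseteq> universe N" "free_vars \<phi> \<subseteq> {..<m + length ps}"
    "X = {xs \<in> tuples m (universe N). sat N (nth (xs @ ps)) \<phi>}"
    using assms by (auto simp: definable_def)
  then show ?thesis unfolding definable_def
    by (intro exI[of _ "Neg \<phi>"] exI[of _ ps]) auto
qed

text \<open>Coordinates for \<open>Y\<close> are read off \<open>xs\<close> or off fixed parameters,
  repetitions allowed. In this way a set of pairs is pulled back to two blocks of a longer tuple,
  possibly the same block twice.\<close>

lemma definable_reindex:
  assumes Y: "definable L N m' Y" and ps: "set ps \<subseteq> universe N"
    and f: "\<And>j. j < m' \<Longrightarrow> f j < m + length ps"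
  shows "definable L N m {xs \<in> tuples m (universe N). map (\<lambda>j. (xs @ ps) ! f j) [0..<m'] \<in> Y}"
proof -
  obtain \<phi> qs where \<phi>: "wf_form L \<phi>" "set qs \<subseteq> universe N" "free_vars \<phi> \<subseteq> {..<m' + length qs}"
    "Y = {xs \<in> tuples m' (universe N). sat N (nth (xs @ qs)) \<phi>}"
    using Y by (auto simp: definable_def)
  \<comment> \<open>The parameters of \<open>Y\<close> itself move behind
    \<open>xs @ ps\<close>.\<close>
  define \<rho> where "\<rho> j = (if j < m' then f j else m + length ps + (j - m'))" for j
  have \<rho>: "\<rho> j < m + length (ps @ qs)" if "j < m' + length qs" for j
    using f[of j] that by (auto simp: \<rho>_def)
  have "map (\<lambda>j. (xs @ ps) ! f j) [0..<m'] \<in> Y \<longleftrightarrow> sat N (nth (xs @ ps @ qs)) (rename \<rho> \<phi>)"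
    if xs: "xs \<in> tuples m (universe N)" for xs
  proof -
    let ?ys = "map (\<lambda>j. (xs @ ps) ! f j) [0..<m']"
    have len: "length xs = m" using xs by (simp add: tuples_def)
    have "(xs @ ps) ! f j \<in> universe N" if "j < m'" for j
      using nth_mem[of "f j" "xs @ ps"] f[OF that] xs ps by (auto simp: tuples_def)
    then have "?ys \<in> tuples m' (universe N)" by (auto simp: tuples_def)
    then have "?ys \<in> Y \<longleftrightarrow> sat N (nth (?ys @ qs)) \<phi>" by (simp add: \<phi>)
    also have "\<dots> \<longleftrightarrow> sat N (\<lambda>i. (xs @ ps @ qs) ! \<rho> i) \<phi>"
    proof (rule sat_cong)
      fix i assume "i \<in> free_vars \<phi>"
      then have "i < m' + length qs" using \<phi> by auto
      then show "(?ys @ qs) ! i = (xs @ ps @ qs) ! \<rho> i"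
        using len f[of i] by (auto simp: \<rho>_def nth_append)
    qed
    finally show ?thesis by (simp add: sat_rename)
  qed
  then have "{xs \<in> tuples m (universe N). map (\<lambda>j. (xs @ ps) ! f j) [0..<m'] \<in> Y} =
      {xs \<in> tuples m (universe N). sat N (nth (xs @ ps @ qs)) (rename \<rho> \<phi>)}" by auto
  moreover have "free_vars (rename \<rho> \<phi>) \<subseteq> {..<m + length (ps @ qs)}"
    using free_vars_rename[of \<rho> \<phi>] \<phi>(3) \<rho> by fastforce
  ultimately show ?thesis unfolding definable_def
    using \<phi>(1,2) ps by (intro exI[of _ "rename \<rho> \<phi>"] exI[of _ "ps @ qs"]) (auto intro: wf_rename)
qed

lemma definable_Int:
  assumes X: "definable L N m X" and Y: "definable L N m Y"
  shows "definable L N m (X \<inter> Y)"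
proof -
  obtain \<phi> ps where \<phi>: "wf_form L \<phi>" "set ps \<subseteq> universe N" "free_vars \<phi> \<subseteq> {..<m + length ps}"
    "X = {xs \<in> tuples m (universe N). sat N (nth (xs @ ps)) \<phi>}"
    using X by (auto simp: definable_def)
  obtain \<psi> qs where \<psi>: "wf_form L \<psi>" "set qs \<subseteq> universe N" "free_vars \<psi> \<subseteq> {..<m + length qs}"
    "Y = {xs \<in> tuples m (universe N). sat N (nth (xs @ qs)) \<psi>}"
    using Y by (auto simp: definable_def)
  \<comment> \<open>Both parameter lists are kept: those of \<open>\<psi>\<close> move behind those
    of \<open>\<phi>\<close>.\<close>
  define \<rho> where "\<rho> j = (if j < m then j else length ps + j)" for j
  have "sat N (nth (xs @ ps @ qs)) (Conj \<phi> (rename \<rho> \<psi>)) \<longleftrightarrow>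
      sat N (nth (xs @ ps)) \<phi> \<and> sat N (nth (xs @ qs)) \<psi>"
    if "xs \<in> tuples m (universe N)" for xs
  proof -
    have len: "length xs = m" using that by (simp add: tuples_def)
    have "sat N (nth (xs @ ps @ qs)) \<phi> \<longleftrightarrow> sat N (nth (xs @ ps)) \<phi>"
      by (rule sat_cong) (use \<phi>(3) len in \<open>auto simp: nth_append\<close>)
    moreover have "sat N (\<lambda>i. (xs @ ps @ qs) ! \<rho> i) \<psi> \<longleftrightarrow> sat N (nth (xs @ qs)) \<psi>"
      by (rule sat_cong) (use \<psi>(3) len in \<open>auto simp: nth_append \<rho>_def\<close>)
    ultimately show ?thesis by (simp add: sat_rename)
  qed
  then have "X \<inter> Y = {xs \<in> tuples m (universe N).
      sat N (nth (xs @ ps @ qs)) (Conj \<phi> (rename \<rho> \<psi>))}"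
    using \<phi>(4) \<psi>(4) by auto
  moreover have "free_vars (Conj \<phi> (rename \<rho> \<psi>)) \<subseteq> {..<m + length (ps @ qs)}"
    using free_vars_rename[of \<rho> \<psi>] \<phi>(3) \<psi>(3) by (fastforce simp: \<rho>_def)
  ultimately show ?thesis unfolding definable_def
    using \<phi>(1,2) \<psi>(1,2)
    by (intro exI[of _ "Conj \<phi> (rename \<rho> \<psi>)"] exI[of _ "ps @ qs"]) (auto intro: wf_rename)
qed

lemma definable_Un:
  assumes "definable L N m X" "definable L N m Y"
  shows "definable L N m (X \<union> Y)"
proof -
  let ?T = "tuples m (universe N)"
  have "definable L N m (?T - ((?T - X) \<inter> (?T - Y)))"
    by (intro definable_Diff definable_Int assms)
  also have "?T - ((?T - X) \<inter> (?T - Y)) = X \<union> Y"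
    using assms[THEN definable_subset] by auto
  finally show ?thesis .
qed

lemma definable_Union:
  assumes "universe N \<noteq> {}" "finite I" "\<And>i. i \<in> I \<Longrightarrow> definable L N m (A i)"
  shows "definable L N m (\<Union>i\<in>I. A i)"
  using assms(2,3)
proof (induction I)
  case empty
  show ?case using definable_Diff[OF definable_tuples[OF assms(1)]] by simp
qed (auto intro: definable_Un)

lemma definable_Inter:
  assumes "universe N \<noteq> {}" "finite I" "\<And>i. i \<in> I \<Longrightarrow> definable L N m (A i)"
  shows "definable L N m {xs \<in> tuples m (universe N). \<forall>i\<in>I. xs \<in> A i}"
proof -
  let ?T = "tuples m (universe N)"
  have "definable L N m (?T - (\<Union>i\<in>I. ?T - A i))"
    by (intro definable_Diff definable_Union assms)
  also have "?T - (\<Union>i\<in>I. ?T - A i) = {xs \<in> ?T. \<forall>i\<in>I. xs \<in> A i}" by auto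
  finally show ?thesis .
qed

section \<open>Atomic types and traces\<close>

text \<open>Sending \<open>v i\<close> to \<open>w i\<close> for \<open>i\<close> in
  \<open>S\<close> is then an isomorphism of induced substructures. Indices rather than subsets
  allow repeated values and match the valuations in \<open>sat\<close>.\<close>

definition same_atoms :: "(unit, unit, 'a) struct \<Rightarrow> nat set \<Rightarrow> (nat \<Rightarrow> 'a) \<Rightarrow> (nat \<Rightarrow> 'a) \<Rightarrow> bool" where
  "same_atoms M S v w \<longleftrightarrow> (\<forall>i\<in>S. \<forall>j\<in>S.
     (v i = v j \<longleftrightarrow> w i = w j) \<and> (rel_of M () [v i, v j] \<longleftrightarrow> rel_of M () [w i, w j]))"

text \<open>The forth half of back-and-forth; the back half follows since \<open>same_atoms\<close>
  is symmetric.\<close>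

definition extension_property :: "(unit, unit, 'a) struct \<Rightarrow> bool" where
  "extension_property M \<longleftrightarrow> (\<forall>S v w i. \<forall>a\<in>universe M.
     finite S \<and> i \<notin> S \<and> v ` S \<subseteq> universe M \<and> w ` S \<subseteq> universe M \<and> same_atoms M S v w \<longrightarrow>
     (\<exists>b\<in>universe M. same_atoms M (insert i S) (v(i := a)) (w(i := b))))"

lemma same_atoms_subset: "same_atoms M S v w \<Longrightarrow> S' \<subseteq> S \<Longrightarrow> same_atoms M S' v w"
  by (auto simp: same_atoms_def)

lemma same_atoms_sym: "same_atoms M S v w \<longleftrightarrow> same_atoms M S w v"
  by (auto simp: same_atoms_def)

lemma wf_trm_binary_language: "wf_trm binary_language t \<longleftrightarrow> (\<exists>i. t = Var i)"
  by (cases t) (auto simp: binary_language_def)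

lemma wf_Rel_binary_language:
  "wf_form binary_language (Rel r ts) \<longleftrightarrow> (\<exists>i j. ts = [Var i, Var j])"
proof -
  have "wf_form binary_language (Rel r ts) \<longleftrightarrow> length ts = 2 \<and> (\<forall>t\<in>set ts. wf_trm binary_language t)"
    by (simp add: binary_language_def)
  also have "\<dots> \<longleftrightarrow> (\<exists>i j. ts = [Var i, Var j])"
    by (auto simp: wf_trm_binary_language length_Suc_conv numeral_2_eq_2)
  finally show ?thesis .
qed

text \<open>Back-and-forth in the quantifier case; the result is quantifier elimination in semantic
  form.\<close>

lemma sat_same_atoms:
  assumes ext: "extension_property M"
  shows "wf_form binary_language \<phi> \<Longrightarrow> v ` free_vars \<phi> \<subseteq> universe M \<Longrightarrow>
    w ` free_vars \<phi> \<subseteq> universe M \<Longrightarrow> same_atoms M (free_vars \<phi>) v w \<Longrightarrow>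
    sat M v \<phi> \<longleftrightarrow> sat M w \<phi>"
proof (induction \<phi> arbitrary: v w)
  case (Equal s t)
  then obtain i j where "s = Var i" "t = Var j" by (auto simp: wf_trm_binary_language)
  with Equal(4) have "v i = v j \<longleftrightarrow> w i = w j" unfolding same_atoms_def by simp
  then show ?case by (simp add: \<open>s = Var i\<close> \<open>t = Var j\<close>)
next
  case (Rel r ts)
  from Rel.prems(1) obtain i j where ts: "ts = [Var i, Var j]"
    unfolding wf_Rel_binary_language by blast
  with Rel(4) have "rel_of M () [v i, v j] \<longleftrightarrow> rel_of M () [w i, w j]"
    unfolding same_atoms_def by simp
  then show ?case by (simp add: ts)
next
  case (Neg \<phi>)
  from Neg.IH[of v w] Neg.prems show ?case by simp
next
  case (Conj \<phi> \<psi>)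
  have "sat M v \<phi> \<longleftrightarrow> sat M w \<phi>"
    by (rule Conj.IH) (use Conj.prems in \<open>auto intro: same_atoms_subset\<close>)
  moreover have "sat M v \<psi> \<longleftrightarrow> sat M w \<psi>"
    by (rule Conj.IH) (use Conj.prems in \<open>auto intro: same_atoms_subset\<close>)
  ultimately show ?case by simp
next
  case (Ex i \<phi>)
  let ?S = "free_vars (Ex i \<phi>)"
  \<comment> \<open>Stated for arbitrary \<open>v\<close> and \<open>w\<close>, so that it can be
    used in both directions.\<close>
  have step: "\<exists>b\<in>universe M. sat M (w(i := b)) \<phi>"
    if v: "v ` ?S \<subseteq> universe M" and w: "w ` ?S \<subseteq> universe M" and vw: "same_atoms M ?S v w"
      and a: "a \<in> universe M" "sat M (v(i := a)) \<phi>" for v w a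
  proof -
    obtain b where b: "b \<in> universe M" "same_atoms M (insert i ?S) (v(i := a)) (w(i := b))"
      using ext v w vw a(1) unfolding extension_property_def
      by (metis DiffD2 finite_free_vars free_vars.simps(5) singletonI)
    have "sat M (v(i := a)) \<phi> \<longleftrightarrow> sat M (w(i := b)) \<phi>"
    proof (rule Ex.IH)
      show "same_atoms M (free_vars \<phi>) (v(i := a)) (w(i := b))"
        by (rule same_atoms_subset[OF b(2)]) auto
    qed (use Ex.prems(1) v w a(1) b(1) in auto)
    then show ?thesis using a(2) b(1) by auto
  qed
  show ?case
    using step[OF Ex.prems(2,3,4)] step[OF Ex.prems(3,2) same_atoms_sym[THEN iffD1, OF Ex.prems(4)]]
    by auto
qed

section \<open>Traces of structures with one binary relation\<close>

lemma concat_map_tuples: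
  assumes "\<And>a. a \<in> A \<Longrightarrow> \<tau> a \<in> tuples n B" "xs \<in> tuples m A"
  shows "concat (map \<tau> xs) \<in> tuples (m * n) B"
  using assms(2)
proof (induction xs arbitrary: m)
  case (Cons x xs)
  then obtain m' where m: "m = Suc m'" "xs \<in> tuples m' A" "x \<in> A" by (auto simp: tuples_def)
  from Cons.IH[OF m(2)] assms(1)[OF m(3)] show ?case by (auto simp: tuples_def m)
qed (simp add: tuples_def)

lemma nth_concat_map:
  assumes "\<And>a. a \<in> set xs \<Longrightarrow> length (\<tau> a) = n" "i < length xs" "r < n"
  shows "concat (map \<tau> xs) ! (i * n + r) = \<tau> (xs ! i) ! r"
  using assms
proof (induction xs arbitrary: i)
  case (Cons x xs)
  then show ?case by (cases i) (auto simp: nth_append add.assoc)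
qed simp

text \<open>
  A definable set is a union of atomic types over its parameters, of which there are finitely
  many, so it is enough to find traces for the atomic formulas.
\<close>

lemma trace_definition_binaryI:
  fixes G :: "(unit, unit, 'a) struct" and N :: "('f, 'r, 'b) struct"
  assumes ext: "extension_property G" and ne: "universe N \<noteq> {}" and n: "n \<ge> 1"
    and \<tau>: "\<And>x. x \<in> universe G \<Longrightarrow> \<tau> x \<in> tuples n (universe N)"
    and E: "definable L N (2 * n) E"
      "\<And>x y. x \<in> universe G \<Longrightarrow> y \<in> universe G \<Longrightarrow> rel_of G () [x, y] \<longleftrightarrow> \<tau> x @ \<tau> y \<in> E"
    and Q: "definable L N (2 * n) Q"
      "\<And>x y. x \<in> universe G \<Longrightarrow> y \<in> universe G \<Longrightarrow> x = y \<longleftrightarrow> \<tau> x @ \<tau> y \<in> Q"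
  shows "trace_definition L N binary_language G n \<tau>"
  unfolding trace_definition_def
proof (intro conjI allI impI ballI)
  fix m :: nat and X assume X: "definable binary_language G m X"
  obtain \<psi> qs where \<psi>: "wf_form binary_language \<psi>" "set qs \<subseteq> universe G"
    "free_vars \<psi> \<subseteq> {..<m + length qs}"
    "X = {xs \<in> tuples m (universe G). sat G (nth (xs @ qs)) \<psi>}"
    using X by (auto simp: definable_def)
  define K where "K = {..<m + length qs} \<times> {..<m + length qs}"
  \<comment> \<open>The atomic diagram of a tuple, as a member of the finite set
    \<open>Pow K \<times> Pow K\<close>.\<close>
  define atoms where "atoms zs = ({(i, j) \<in> K. zs ! i = zs ! j}, {(i, j) \<in> K. rel_of G () [zs ! i, zs ! j]})"
    for zs :: "'a list"
  define D where "D = (\<lambda>xs. atoms (xs @ qs)) ` X"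
  have "D \<subseteq> Pow K \<times> Pow K" by (auto simp: D_def atoms_def)
  then have finD: "finite D" by (rule finite_subset) (simp add: K_def)
  \<comment> \<open>Tuples with the same diagram over \<open>qs\<close> agree on
    \<open>\<psi>\<close>, so \<open>X\<close> is recovered from its diagrams.\<close>
  have XD: "xs \<in> X \<longleftrightarrow> atoms (xs @ qs) \<in> D" if xs: "xs \<in> tuples m (universe G)" for xs
  proof
    assume "atoms (xs @ qs) \<in> D"
    then obtain ys where ys: "ys \<in> X" "atoms (xs @ qs) = atoms (ys @ qs)" by (auto simp: D_def)
    then have ysT: "ys \<in> tuples m (universe G)" by (simp add: \<psi>)
    have "same_atoms G {..<m + length qs} (nth (xs @ qs)) (nth (ys @ qs))"
      using ys(2) unfolding same_atoms_def atoms_def K_def set_eq_iff prod.inject by auto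
    then have "same_atoms G (free_vars \<psi>) (nth (xs @ qs)) (nth (ys @ qs))"
      by (rule same_atoms_subset) (use \<psi> in simp)
    moreover have "nth (zs @ qs) ` free_vars \<psi> \<subseteq> universe G" if "zs \<in> tuples m (universe G)" for zs
    proof -
      have "set (zs @ qs) \<subseteq> universe G" "length (zs @ qs) = m + length qs"
        using that \<psi>(2) by (auto simp: tuples_def)
      then show ?thesis using \<psi>(3) nth_mem[of _ "zs @ qs"] by fastforce
    qed
    ultimately have "sat G (nth (xs @ qs)) \<psi> \<longleftrightarrow> sat G (nth (ys @ qs)) \<psi>"
      using sat_same_atoms[OF ext \<psi>(1)] xs ysT by blast
    then show "xs \<in> X" using ys(1) xs \<psi>(4) by auto
  qed (auto simp: D_def)
  define ps where "ps = concat (map \<tau> qs)"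
  have ps: "ps \<in> tuples (length qs * n) (universe N)"
    unfolding ps_def by (rule concat_map_tuples[OF \<tau>]) (use \<psi>(2) in \<open>auto simp: tuples_def\<close>)
  \<comment> \<open>Cuts blocks \<open>i\<close> and \<open>j\<close>, each of length
    \<open>n\<close>, out of \<open>ws @ ps\<close>; blocks from \<open>m\<close> on are the codes
    of the parameters \<open>qs\<close>.\<close>
  define blk where "blk i j ws = map (\<lambda>r. (ws @ ps) ! (if r < n then i * n + r else j * n + (r - n))) [0..<2 * n]"
    for i j and ws :: "'b list"
  define pull where "pull W i j = {ws \<in> tuples (m * n) (universe N). blk i j ws \<in> W}" for W i j
  have pull: "definable L N (m * n) (pull W i j)" if "(i, j) \<in> K" "definable L N (2 * n) W" for i j W
    unfolding pull_def blk_def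
  proof (rule definable_reindex[OF that(2)])
    show "set ps \<subseteq> universe N" using ps by (simp add: tuples_def)
    fix r assume r: "r < 2 * n"
    have *: "i' * n + r' < m * n + length ps" if "i' < m + length qs" "r' < n" for i' r'
    proof -
      have "i' * n + r' < Suc i' * n" using that by simp
      also have "\<dots> \<le> (m + length qs) * n" using that by (intro mult_le_mono1) simp
      finally show ?thesis using ps by (simp add: tuples_def algebra_simps)
    qed
    show "(if r < n then i * n + r else j * n + (r - n)) < m * n + length ps"
      using *[of i r] *[of j "r - n"] that(1) r by (auto simp: K_def)
  qed
  have blk: "blk i j (concat (map \<tau> xs)) = \<tau> ((xs @ qs) ! i) @ \<tau> ((xs @ qs) ! j)"
    and mem: "(xs @ qs) ! i \<in> universe G" "(xs @ qs) ! j \<in> universe G"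
    if "(i, j) \<in> K" "xs \<in> tuples m (universe G)" for i j xs
  proof -
    have zs: "set (xs @ qs) \<subseteq> universe G" "length (xs @ qs) = m + length qs"
      using that \<psi>(2) by (auto simp: tuples_def)
    then show mem: "(xs @ qs) ! i \<in> universe G" "(xs @ qs) ! j \<in> universe G"
      using that(1) nth_mem[of _ "xs @ qs"] by (auto simp: K_def)
    have len: "length (\<tau> x) = n" if "x \<in> universe G" for x using \<tau>[OF that] by (simp add: tuples_def)
    have at: "(concat (map \<tau> xs) @ ps) ! (i' * n + r) = \<tau> ((xs @ qs) ! i') ! r"
      if "i' < m + length qs" "r < n" for i' r
      using nth_concat_map[of "xs @ qs" \<tau> n i' r] zs len that by (auto simp: ps_def)
    have "blk i j (concat (map \<tau> xs)) ! r = (\<tau> ((xs @ qs) ! i) @ \<tau> ((xs @ qs) ! j)) ! r"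
      if "r < 2 * n" for r
      using that at[of i r] at[of j "r - n"] \<open>(i, j) \<in> K\<close> len[OF mem(1)]
      by (cases "r < n") (simp_all add: blk_def K_def nth_append[of "\<tau> _"])
    then show "blk i j (concat (map \<tau> xs)) = \<tau> ((xs @ qs) ! i) @ \<tau> ((xs @ qs) ! j)"
      using len[OF mem(1)] len[OF mem(2)] by (intro nth_equalityI) (auto simp: blk_def)
  qed
  define lit where "lit W s i j = (if (i, j) \<in> s then pull W i j else tuples (m * n) (universe N) - pull W i j)"
    for W s i j
  have lit: "definable L N (m * n) (lit W s i j)" if "(i, j) \<in> K" "definable L N (2 * n) W" for W s i j
    using pull[OF that] by (auto simp: lit_def intro: definable_Diff)
  define Z where "Z t = {ws \<in> tuples (m * n) (universe N).
      \<forall>p\<in>K. ws \<in> lit Q (fst t) (fst p) (snd p) \<inter> lit E (snd t) (fst p) (snd p)}" for t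
  have Z: "definable L N (m * n) (Z t)" for t
    unfolding Z_def
    by (rule definable_Inter[OF ne]) (auto simp: K_def intro!: definable_Int lit E(1) Q(1))
  define Y where "Y = (\<Union>t\<in>D. Z t)"
  have "definable L N (m * n) Y" unfolding Y_def by (rule definable_Union[OF ne finD Z])
  moreover have "xs \<in> X \<longleftrightarrow> concat (map \<tau> xs) \<in> Y" if xs: "xs \<in> tuples m (universe G)" for xs
  proof -
    let ?ws = "concat (map \<tau> xs)"
    have ws: "?ws \<in> tuples (m * n) (universe N)" by (rule concat_map_tuples[OF \<tau> xs])
    have Q': "?ws \<in> pull Q i j \<longleftrightarrow> (xs @ qs) ! i = (xs @ qs) ! j"
      and E': "?ws \<in> pull E i j \<longleftrightarrow> rel_of G () [(xs @ qs) ! i, (xs @ qs) ! j]" if "(i, j) \<in> K" for i j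
      using ws Q(2)[OF mem[OF that xs]] E(2)[OF mem[OF that xs]] blk[OF that xs]
      by (simp_all add: pull_def)
    \<comment> \<open>\<open>Z t\<close> decides every pair of positions positively or negatively,
      so only the diagram of \<open>xs\<close> itself fits.\<close>
    have "?ws \<in> Z t \<longleftrightarrow> t = atoms (xs @ qs)" if "t \<in> D" for t
    proof -
      obtain s u where t: "t = (s, u)" by (cases t)
      have su: "s \<subseteq> K" "u \<subseteq> K" using \<open>D \<subseteq> Pow K \<times> Pow K\<close> that t by auto
      have "?ws \<in> Z t \<longleftrightarrow> (\<forall>(i, j)\<in>K. ((i, j) \<in> s \<longleftrightarrow> (xs @ qs) ! i = (xs @ qs) ! j) \<and>
          ((i, j) \<in> u \<longleftrightarrow> rel_of G () [(xs @ qs) ! i, (xs @ qs) ! j]))"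
        using ws Q' E' by (auto simp: Z_def lit_def t)
      also have "\<dots> \<longleftrightarrow> s = {(i, j) \<in> K. (xs @ qs) ! i = (xs @ qs) ! j} \<and>
          u = {(i, j) \<in> K. rel_of G () [(xs @ qs) ! i, (xs @ qs) ! j]}"
        using su by fast
      finally show ?thesis by (simp add: t atoms_def)
    qed
    then show ?thesis unfolding XD[OF xs] Y_def by auto
  qed
  then have "X = {xs \<in> tuples m (universe G). concat (map \<tau> xs) \<in> Y}"
    using definable_subset[OF X] by auto
  ultimately show "\<exists>Y. definable L N (m * n) Y \<and>
      X = {xs \<in> tuples m (universe G). concat (map \<tau> xs) \<in> Y}" by blast
qed (use n \<tau> in auto)

section \<open>One-point extensions in the rationals and in ultrahomogeneous structures\<close>

lemma rel_of_rat_order [simp]: "rel_of rat_order () [x, y] \<longleftrightarrow> x < y"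
  by (simp add: rat_order_def binary_struct_def)

lemma universe_rat_order [simp]: "universe rat_order = UNIV"
  by (simp add: rat_order_def binary_struct_def)

text \<open>Density separates two nonempty sets, absence of endpoints covers an empty one. Inserting
  0 gives \<open>Min\<close> and \<open>Max\<close> a nonempty argument.\<close>

lemma finite_sets_separated:
  fixes A B :: "rat set"
  assumes "finite A" "finite B" "\<And>x y. x \<in> A \<Longrightarrow> y \<in> B \<Longrightarrow> x < y"
  shows "\<exists>z. (\<forall>x\<in>A. x < z) \<and> (\<forall>y\<in>B. z < y)"
proof (cases "A = {} \<or> B = {}")
  case True
  then show ?thesis
  proof
    assume "A = {}"
    obtain z where "z < Min (insert 0 B)" using lt_ex by blast
    then have "\<forall>y\<in>B. z < y" using assms(2) by (meson Min_le finite.insertI insertCI less_le_trans)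
    with \<open>A = {}\<close> show ?thesis by auto
  next
    assume "B = {}"
    obtain z where "Max (insert 0 A) < z" using gt_ex by blast
    then have "\<forall>x\<in>A. x < z" using assms(1) by (meson Max_ge finite.insertI insertCI le_less_trans)
    with \<open>B = {}\<close> show ?thesis by auto
  qed
next
  case False
  then have "Max A < Min B" using assms by simp
  then obtain z where "Max A < z" "z < Min B" using dense by blast
  then have "\<forall>x\<in>A. x < z" "\<forall>y\<in>B. z < y" using False assms(1,2) by auto
  then show ?thesis by blast
qed

lemma extension_property_rat_order: "extension_property rat_order"
  unfolding extension_property_def
proof (intro allI ballI impI)
  fix S and v w :: "nat \<Rightarrow> rat" and i a
  assume "finite S \<and> i \<notin> S \<and> v ` S \<subseteq> universe rat_order \<and> w ` S \<subseteq> universe rat_order \<and>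
    same_atoms rat_order S v w"
  then have S: "finite S" "i \<notin> S" and eq: "\<And>j k. j \<in> S \<Longrightarrow> k \<in> S \<Longrightarrow> v j = v k \<longleftrightarrow> w j = w k"
    and less: "\<And>j k. j \<in> S \<Longrightarrow> k \<in> S \<Longrightarrow> v j < v k \<longleftrightarrow> w j < w k"
    by (auto simp: same_atoms_def)
  have "\<exists>b. \<forall>j\<in>S. (a = v j \<longleftrightarrow> b = w j) \<and> (a < v j \<longleftrightarrow> b < w j) \<and> (v j < a \<longleftrightarrow> w j < b)"
  proof (cases "a \<in> v ` S")
    case True
    then obtain k where "k \<in> S" "a = v k" by auto
    then show ?thesis using eq less by (intro exI[of _ "w k"]) auto
  next
    case False
    \<comment> \<open>\<open>a\<close> cuts the values of \<open>v\<close> in two; \<open>w\<close>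
      carries the lower part strictly below the upper one, and a rational fits into the
      corresponding cut.\<close>
    have "\<exists>b. (\<forall>x\<in>w ` {j \<in> S. v j < a}. x < b) \<and> (\<forall>y\<in>w ` {j \<in> S. a < v j}. b < y)"
      using S by (intro finite_sets_separated) (auto simp flip: less)
    then obtain b where b: "\<forall>j\<in>S. v j < a \<longrightarrow> w j < b" "\<forall>j\<in>S. a < v j \<longrightarrow> b < w j" by auto
    have "(a = v j \<longleftrightarrow> b = w j) \<and> (a < v j \<longleftrightarrow> b < w j) \<and> (v j < a \<longleftrightarrow> w j < b)" if "j \<in> S" for j
      using that b False linorder_less_linear[of a "v j"]
      by (metis image_eqI less_irrefl less_asym)
    then show ?thesis by blast
  qed
  then obtain b where b: "\<And>j. j \<in> S \<Longrightarrow> a = v j \<longleftrightarrow> b = w j" "\<And>j. j \<in> S \<Longrightarrow> a < v j \<longleftrightarrow> b < w j"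
    "\<And>j. j \<in> S \<Longrightarrow> v j < a \<longleftrightarrow> w j < b" by blast
  have "same_atoms rat_order (insert i S) (v(i := a)) (w(i := b))"
    unfolding same_atoms_def
  proof (intro ballI)
    fix j k assume "j \<in> insert i S" "k \<in> insert i S"
    then show "((v(i := a)) j = (v(i := a)) k \<longleftrightarrow> (w(i := b)) j = (w(i := b)) k) \<and>
        (rel_of rat_order () [(v(i := a)) j, (v(i := a)) k] \<longleftrightarrow>
         rel_of rat_order () [(w(i := b)) j, (w(i := b)) k])"
      using b(1)[of j] b(2)[of j] b(3)[of j] b(1)[of k] b(2)[of k] b(3)[of k] eq[of j k] less[of j k] S(2)
      by (cases "j = i"; cases "k = i") auto
  qed
  then show "\<exists>b\<in>universe rat_order. same_atoms rat_order (insert i S) (v(i := a)) (w(i := b))" by auto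
qed

lemma tuples_2: "xs \<in> tuples 2 A \<longleftrightarrow> (\<exists>x\<in>A. \<exists>y\<in>A. xs = [x, y])"
  by (auto simp: tuples_def length_Suc_conv numeral_2_eq_2)

lemma embedding_binary:
  "embedding binary_language A B h \<longleftrightarrow> h ` universe A \<subseteq> universe B \<and> inj_on h (universe A) \<and>
     (\<forall>x\<in>universe A. \<forall>y\<in>universe A. rel_of A () [x, y] \<longleftrightarrow> rel_of B () [h x, h y])"
proof -
  have "embedding binary_language A B h \<longleftrightarrow> h ` universe A \<subseteq> universe B \<and> inj_on h (universe A) \<and>
     (\<forall>xs\<in>tuples 2 (universe A). rel_of A () xs \<longleftrightarrow> rel_of B () (map h xs))"
    by (simp add: embedding_def binary_language_def)
  then show ?thesis by (auto simp: tuples_2)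
qed

lemma is_struct_binary: "is_struct binary_language A \<longleftrightarrow> universe A \<noteq> {}"
  by (simp add: is_struct_def closed_under_def binary_language_def)

text \<open>Extend the finite partial isomorphism to an automorphism \<open>g\<close>; then
  \<open>g a\<close> is the required point.\<close>

lemma extension_property_ultrahomogeneous:
  assumes "ultrahomogeneous binary_language G"
  shows "extension_property G"
  unfolding extension_property_def
proof (intro allI ballI impI)
  fix S v w i a
  assume a: "a \<in> universe G" and "finite S \<and> i \<notin> S \<and> v ` S \<subseteq> universe G \<and> w ` S \<subseteq> universe G \<and>
    same_atoms G S v w"
  then have S: "finite S" "i \<notin> S" and vw: "v ` S \<subseteq> universe G" "w ` S \<subseteq> universe G"
    and eq: "\<And>j k. j \<in> S \<Longrightarrow> k \<in> S \<Longrightarrow> v j = v k \<longleftrightarrow> w j = w k"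
    and rel: "\<And>j k. j \<in> S \<Longrightarrow> k \<in> S \<Longrightarrow> rel_of G () [v j, v k] \<longleftrightarrow> rel_of G () [w j, w k]"
    by (auto simp: same_atoms_def)
  have "\<exists>g. embedding binary_language G G g \<and> (\<forall>j\<in>S. g (v j) = w j)"
  \<comment> \<open>Structures have nonempty universes, so ultrahomogeneity does not speak about the
    empty partial map; the identity serves there.\<close>
  proof (cases "S = {}")
    case True
    then show ?thesis by (intro exI[of _ id]) (simp add: embedding_binary)
  next
    case False
    \<comment> \<open>Any index of \<open>x\<close> may be chosen, since equal values of
      \<open>v\<close> have equal values of \<open>w\<close>.\<close>
    define h where "h = (\<lambda>x. w (SOME j. j \<in> S \<and> v j = x))"
    have h: "h (v j) = w j" if "j \<in> S" for j
      using someI[of "\<lambda>k. k \<in> S \<and> v k = v j" j] that eq[of _ j] unfolding h_def by blast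
    let ?A = "G\<lparr>universe := v ` S\<rparr>" and ?B = "G\<lparr>universe := w ` S\<rparr>"
    have fg: "substruct binary_language (G\<lparr>universe := u ` S\<rparr>) G \<and>
        finitely_generated binary_language (G\<lparr>universe := u ` S\<rparr>)"
      if "u ` S \<subseteq> universe G" for u
      using False S(1) that unfolding substruct_def finitely_generated_def is_struct_binary
      by (auto intro!: exI[of _ "u ` S"])
    have "isomorphism binary_language ?A ?B h"
      unfolding isomorphism_def embedding_binary using h eq rel
      by (auto simp: inj_on_def image_image)
    then obtain g where "isomorphism binary_language G G g" "\<forall>x\<in>universe ?A. g x = h x"
      using assms fg[OF vw(1)] fg[OF vw(2)] unfolding ultrahomogeneous_def by blast
    then show ?thesis using h by (auto simp: isomorphism_def)
  qed
  then obtain g where g: "embedding binary_language G G g" "\<And>j. j \<in> S \<Longrightarrow> w j = g (v j)" by auto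
  have "same_atoms G (insert i S) (v(i := a)) (w(i := g a))"
  proof -
    have "(w(i := g a)) j = g ((v(i := a)) j)" "(v(i := a)) j \<in> universe G" if "j \<in> insert i S" for j
      using that g(2) vw a by auto
    then show ?thesis using g(1) unfolding same_atoms_def embedding_binary
      by (metis inj_on_eq_iff)
  qed
  moreover have "g a \<in> universe G" using g(1) a by (auto simp: embedding_binary)
  ultimately show "\<exists>b\<in>universe G. same_atoms G (insert i S) (v(i := a)) (w(i := b))" by blast
qed

text \<open>Definable sets are carried over by moving their parameters along \<open>h\<close>. This
  serves to place a copy of \<open>rat_order\<close> in another type.\<close>

lemma trace_definition_isomorphism:
  assumes tr: "trace_definition L N L' M n \<tau>" and M': "is_struct L' M'" and h: "isomorphism L' M' M h"
  shows "trace_definition L N L' M' n (\<tau> \<circ> h)"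
  unfolding trace_definition_def
proof (intro conjI allI impI ballI)
  have inj: "inj_on h (universe M')" and sur: "h ` universe M' = universe M"
    using h by (auto simp: isomorphism_def embedding_def)
  show "n \<ge> 1" using tr by (simp add: trace_definition_def)
  show "(\<tau> \<circ> h) a \<in> tuples n (universe N)" if "a \<in> universe M'" for a
    using tr that sur by (auto simp: trace_definition_def)
  fix m :: nat and X assume m: "m \<ge> 1" and X: "definable L' M' m X"
  obtain \<phi> ps where \<phi>: "wf_form L' \<phi>" "set ps \<subseteq> universe M'" "free_vars \<phi> \<subseteq> {..<m + length ps}"
    "X = {xs \<in> tuples m (universe M'). sat M' (nth (xs @ ps)) \<phi>}"
    using X by (auto simp: definable_def)
  define X' where "X' = {xs \<in> tuples m (universe M). sat M (nth (xs @ map h ps)) \<phi>}"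
  have "definable L' M m X'"
    unfolding definable_def X'_def using \<phi> sur by (intro exI[of _ \<phi>] exI[of _ "map h ps"]) auto
  then obtain Y where Y: "definable L N (m * n) Y"
    "X' = {xs \<in> tuples m (universe M). concat (map \<tau> xs) \<in> Y}"
    using tr m unfolding trace_definition_def by blast
  have "xs \<in> X \<longleftrightarrow> concat (map (\<tau> \<circ> h) xs) \<in> Y" if xs: "xs \<in> tuples m (universe M')" for xs
  proof -
    have hxs: "map h xs \<in> tuples m (universe M)" using xs sur by (auto simp: tuples_def)
    have "xs \<in> X \<longleftrightarrow> sat M' (nth (xs @ ps)) \<phi>" using xs \<phi> by simp
    also have "\<dots> \<longleftrightarrow> sat M (nth (map h (xs @ ps))) \<phi>"
      by (rule sat_nth_isomorphism[OF M' h \<phi>(1)]) (use xs \<phi> in \<open>auto simp: tuples_def\<close>)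
    also have "\<dots> \<longleftrightarrow> map h xs \<in> X'" using hxs by (simp add: X'_def)
    also have "\<dots> \<longleftrightarrow> concat (map (\<tau> \<circ> h) xs) \<in> Y" using hxs by (simp add: Y(2))
    finally show ?thesis .
  qed
  then have "X = {xs \<in> tuples m (universe M'). concat (map (\<tau> \<circ> h) xs) \<in> Y}"
    using definable_subset[OF X] by auto
  with Y(1) show "\<exists>Y. definable L N (m * n) Y \<and>
      X = {xs \<in> tuples m (universe M'). concat (map (\<tau> \<circ> h) xs) \<in> Y}" by blast
qed

section \<open>Order property, independence property and traces\<close>

text \<open>
  A vertex \<open>x\<close> with index \<open>i\<close> is coded by \<open>a i\<close>, \<open>b (2 * i)\<close> and \<open>b (2 * i + 1)\<close>. The even columns
  of the pattern code the relation, the odd ones its symmetric difference with equality, so that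
  equality is traced as well. For a strict order the columns are the
  strict and the nonstrict order, which the order property realizes on a finite set after scaling
  ranks by two.
\<close>

definition code_pattern :: "(unit, unit, 'a) struct \<Rightarrow> nat \<Rightarrow> nat \<Rightarrow> bool" where
  "code_pattern G i j \<longleftrightarrow>
     (let x = from_nat_into (universe G) i; y = from_nat_into (universe G) (j div 2)
      in rel_of G () [x, y] \<noteq> (odd j \<and> x = y))"

lemma trace_defines_if_codes:
  fixes M :: "('f, 'r, 'u) struct" and G :: "(unit, unit, 'a) struct"
  assumes T: "T \<subseteq> sentences L" and large: "large_type TYPE('u) L" and M: "is_model L T M"
    and \<phi>: "wf_form L \<phi>" "free_vars \<phi> \<subseteq> {..<k + l}"
    and G: "countable (universe G)" "extension_property G"
    and fin: "\<And>n :: nat. \<exists>a b. (\<forall>i<n. a i \<in> tuples k (universe M) \<and> b i \<in> tuples l (universe M)) \<and>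
      (\<forall>i<n. \<forall>j<n. sat M (nth (a i @ b j)) \<phi> \<longleftrightarrow> code_pattern G i j)"
  shows "theory_trace_defines TYPE('u) L T binary_language G"
proof -
  obtain N :: "('f, 'r, 'u) struct" and a b where N: "is_model L T N"
    and a: "\<And>i. a i \<in> tuples k (universe N)" and b: "\<And>i. b i \<in> tuples l (universe N)"
    and ab: "\<And>i j. sat N (nth (a i @ b j)) \<phi> \<longleftrightarrow> code_pattern G i j"
    using ex_model_coding[OF T large M \<phi> fin] by blast
  have ne: "universe N \<noteq> {}" using N by (auto simp: is_model_def is_struct_def)
  then obtain c where c: "c \<in> universe N" by auto
  define e where "e = to_nat_on (universe G)"
  have de: "from_nat_into (universe G) (e x) = x" if "x \<in> universe G" for x
    using from_nat_into_to_nat_on[OF G(1) that] by (simp add: e_def)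
  \<comment> \<open>The entry \<open>c\<close> only ensures that the tuples are nonempty.\<close>
  define \<tau> where "\<tau> x = a (e x) @ b (2 * e x) @ b (2 * e x + 1) @ [c]" for x
  define n where "n = k + l + l + 1"
  have \<tau>: "\<tau> x \<in> tuples n (universe N)" for x
    using a[of "e x"] b[of "2 * e x"] b[of "2 * e x + 1"] c by (auto simp: \<tau>_def n_def tuples_def)
  \<comment> \<open>For \<open>k \<le> j\<close> the entry \<open>n + j\<close> of
    \<open>\<tau> x @ \<tau> y\<close> lies in the even column of \<open>y\<close>; the shift by
    \<open>l\<close> selects the odd column instead.\<close>
  define D where "D c = {zs \<in> tuples (2 * n) (universe N).
      map (\<lambda>j. (zs @ []) ! (if j < k then j else n + j + of_bool c * l)) [0..<k + l]
      \<in> {xs \<in> tuples (k + l) (universe N). sat N (nth (xs @ [])) \<phi>}}" for c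
  have D: "definable L N (2 * n) (D c)" for c
    unfolding D_def
  proof (rule definable_reindex)
    show "definable L N (k + l) {xs \<in> tuples (k + l) (universe N). sat N (nth (xs @ [])) \<phi>}"
      unfolding definable_def using \<phi> by (intro exI[of _ \<phi>] exI[of _ "[]"]) auto
  qed (auto simp: n_def)
  have len: "length (a i) = k" "length (b i) = l" for i using a[of i] b[of i] by (auto simp: tuples_def)
  have mapD: "map (\<lambda>j. (\<tau> x @ \<tau> y) ! (if j < k then j else n + j + of_bool c * l)) [0..<k + l] =
      a (e x) @ b (2 * e y + of_bool c)" for x y c
    by (rule nth_equalityI) (auto simp: len \<tau>_def n_def nth_append)
  have memD: "\<tau> x @ \<tau> y \<in> D c \<longleftrightarrow> code_pattern G (e x) (2 * e y + of_bool c)" for x y c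
  proof -
    have "\<tau> x @ \<tau> y \<in> tuples (2 * n) (universe N)" using \<tau>[of x] \<tau>[of y] by (auto simp: tuples_def)
    moreover have "a i @ b j \<in> tuples (k + l) (universe N)" for i j
      using a[of i] b[of j] by (auto simp: tuples_def)
    ultimately show ?thesis by (simp only: D_def mapD append_Nil2 mem_Collect_eq ab simp_thms)
  qed
  let ?T = "tuples (2 * n) (universe N)"
  have "trace_definition L N binary_language G n \<tau>"
  proof (rule trace_definition_binaryI[OF G(2) ne _ \<tau> D[of False]])
    show "rel_of G () [x, y] \<longleftrightarrow> \<tau> x @ \<tau> y \<in> D False" if "x \<in> universe G" "y \<in> universe G" for x y
      using memD[of x y False] that by (simp add: code_pattern_def de)
    \<comment> \<open>The two columns of \<open>y\<close> disagree on \<open>x\<close> exactly when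
      \<open>x = y\<close>, so equality is traced by the symmetric difference.\<close>
    show "definable L N (2 * n) (D False \<inter> (?T - D True) \<union> D True \<inter> (?T - D False))"
      by (intro definable_Un definable_Int definable_Diff D)
    show "x = y \<longleftrightarrow> \<tau> x @ \<tau> y \<in> D False \<inter> (?T - D True) \<union> D True \<inter> (?T - D False)"
      if "x \<in> universe G" "y \<in> universe G" for x y
      using memD[of x y False] memD[of x y True] \<tau>[of x] \<tau>[of y] that
      by (auto simp: code_pattern_def de tuples_def)
  qed (simp_all add: n_def)
  then show ?thesis using N by (auto simp: theory_trace_defines_def struct_trace_defines_def)
qed

section \<open>Traces from the order property and from the independence property\<close>

lemma trace_defines_rat_order_if_unstable:
  fixes L :: "('f, 'r) language"
  assumes T: "T \<subseteq> sentences L" and large: "large_type TYPE('u) L" and u: "unstable TYPE('u) L T"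
  shows "theory_trace_defines TYPE('u) L T binary_language rat_order"
proof -
  obtain M :: "('f, 'r, 'u) struct" and k l \<phi> where M: "is_model L T M" and \<phi>: "wf_form L \<phi>"
    "free_vars \<phi> \<subseteq> {..<k + l}" and op: "has_order_property M k l \<phi>"
    using u by (auto simp: unstable_def)
  obtain a b where ab: "\<And>i. a i \<in> tuples k (universe M)" "\<And>i. b i \<in> tuples l (universe M)"
    "\<And>i j :: nat. sat M (nth (a i @ b j)) \<phi> \<longleftrightarrow> i < j"
    using op by (auto simp: has_order_property_def)
  show ?thesis
  proof (rule trace_defines_if_codes[OF T large M \<phi> _ extension_property_rat_order])
    fix n :: nat
    define d where "d = from_nat_into (UNIV :: rat set)"
    \<comment> \<open>Ranks reflect the order of the first \<open>n\<close> enumerated rationals.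
      Doubling leaves an odd number between consecutive values, so adding 1 on the right turns
      \<open><\<close> into \<open>\<le>\<close>, as the odd columns require.\<close>
    define rk where "rk i = card {q \<in> d ` {..<n}. q < d i}" for i
    have less: "rk i < rk j" if "i < n" "d i < d j" for i j
      unfolding rk_def by (rule psubset_card_mono) (use that in auto)
    have rk: "2 * rk i < 2 * rk j + of_bool c \<longleftrightarrow> (d i < d j) \<noteq> (c \<and> d i = d j)"
      if "i < n" "j < n" for i j c
      using less[of i j] less[of j i] that
      by (cases "d i" "d j" rule: linorder_cases; cases c) (auto simp: rk_def)
    have pat: "code_pattern rat_order i j \<longleftrightarrow> 2 * rk i < 2 * rk (j div 2) + of_bool (odd j)"
      if "i < n" "j < n" for i j
      using rk[of i "j div 2" "odd j"] that by (simp add: code_pattern_def d_def Let_def)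
    show "\<exists>a b. (\<forall>i<n. a i \<in> tuples k (universe M) \<and> b i \<in> tuples l (universe M)) \<and>
        (\<forall>i<n. \<forall>j<n. sat M (nth (a i @ b j)) \<phi> \<longleftrightarrow> code_pattern rat_order i j)"
      by (intro exI[of _ "\<lambda>i. a (2 * rk i)"] exI[of _ "\<lambda>j. b (2 * rk (j div 2) + of_bool (odd j))"])
        (simp add: ab pat)
  qed simp
qed

lemma trace_defines_ultrahomogeneous_if_IP:
  fixes L :: "('f, 'r) language"
  assumes T: "T \<subseteq> sentences L" and large: "large_type TYPE('u) L" and ip: "has_IP TYPE('u) L T"
    and G: "countable (universe G)" "ultrahomogeneous binary_language G"
  shows "theory_trace_defines TYPE('u) L T binary_language G"
proof -
  obtain M :: "('f, 'r, 'u) struct" and k l \<phi> where M: "is_model L T M" and \<phi>: "wf_form L \<phi>"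
    "free_vars \<phi> \<subseteq> {..<k + l}" and sh: "\<And>n. shatters M k l \<phi> n"
    using ip by (auto simp: has_IP_def)
  show ?thesis
  proof (rule trace_defines_if_codes[OF T large M \<phi> G(1) extension_property_ultrahomogeneous[OF G(2)]])
    fix n :: nat
    obtain a b where ab: "\<forall>i<n. a i \<in> tuples k (universe M)"
      "\<forall>I\<subseteq>{..<n}. b I \<in> tuples l (universe M)"
      "\<forall>i<n. \<forall>I\<subseteq>{..<n}. sat M (nth (a i @ b I)) \<phi> \<longleftrightarrow> i \<in> I"
      using sh[of n] unfolding shatters_def by (elim exE conjE)
    \<comment> \<open>Shattering realizes any pattern on finitely many rows: column \<open>j\<close>
      is given by the set of rows that it has to select.\<close>
    have I: "{i \<in> {..<n}. code_pattern G i j} \<subseteq> {..<n}" for j by auto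
    show "\<exists>a b. (\<forall>i<n. a i \<in> tuples k (universe M) \<and> b i \<in> tuples l (universe M)) \<and>
        (\<forall>i<n. \<forall>j<n. sat M (nth (a i @ b j)) \<phi> \<longleftrightarrow> code_pattern G i j)"
      using ab(1) ab(2)[rule_format, OF I] ab(3)[rule_format, OF _ I]
      by (intro exI[of _ a] exI[of _ "\<lambda>j. b {i \<in> {..<n}. code_pattern G i j}"]) simp
  qed
qed

section \<open>Formulas with the order property or the independence property from traces\<close>

lemma trace_definition_binaryE:
  assumes "trace_definition L N binary_language G n \<tau>"
  obtains \<phi> ps where "wf_form L \<phi>" "set ps \<subseteq> universe N" "free_vars \<phi> \<subseteq> {..<n + (n + length ps)}"
    "\<And>x y. x \<in> universe G \<Longrightarrow> y \<in> universe G \<Longrightarrow>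
       rel_of G () [x, y] \<longleftrightarrow> sat N (nth (\<tau> x @ \<tau> y @ ps)) \<phi>"
proof -
  have \<tau>: "\<tau> x \<in> tuples n (universe N)" if "x \<in> universe G" for x
    using assms that by (simp add: trace_definition_def)
  let ?X = "{xs \<in> tuples 2 (universe G). sat G (nth (xs @ [])) (Rel () [Var 0, Var 1])}"
  have "definable binary_language G 2 ?X"
    unfolding definable_def
    by (intro exI[of _ "Rel () [Var 0, Var 1]"] exI[of _ "[]"]) (auto simp: binary_language_def)
  note X = this
  have "\<forall>m\<ge>1. \<forall>X. definable binary_language G m X \<longrightarrow> (\<exists>Y. definable L N (m * n) Y \<and>
      X = {xs \<in> tuples m (universe G). concat (map \<tau> xs) \<in> Y})"
    using assms by (simp add: trace_definition_def)
  from this[rule_format, OF one_le_numeral X]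
  obtain Y where Y: "definable L N (2 * n) Y"
    "?X = {xs \<in> tuples 2 (universe G). concat (map \<tau> xs) \<in> Y}"
    by (elim exE conjE)
  obtain \<phi> ps where \<phi>: "wf_form L \<phi>" "set ps \<subseteq> universe N" "free_vars \<phi> \<subseteq> {..<2 * n + length ps}"
    "Y = {xs \<in> tuples (2 * n) (universe N). sat N (nth (xs @ ps)) \<phi>}"
    using Y(1) by (auto simp: definable_def)
  have "rel_of G () [x, y] \<longleftrightarrow> sat N (nth (\<tau> x @ \<tau> y @ ps)) \<phi>"
    if "x \<in> universe G" "y \<in> universe G" for x y
  proof -
    have "rel_of G () [x, y] \<longleftrightarrow> [x, y] \<in> ?X" using that by (simp add: tuples_2)
    also have "\<dots> \<longleftrightarrow> \<tau> x @ \<tau> y \<in> Y" unfolding Y(2) using that by (simp add: tuples_2)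
    also have "\<dots> \<longleftrightarrow> sat N (nth (\<tau> x @ \<tau> y @ ps)) \<phi>"
      using \<tau>[OF that(1)] \<tau>[OF that(2)] by (simp add: \<phi>(4) tuples_def)
    finally show ?thesis .
  qed
  \<comment> \<open>The bound is regrouped so that \<open>\<phi>\<close> reads as a partitioned
    formula whose second tuple is \<open>\<tau> y @ ps\<close>; the parameters are absorbed
    there.\<close>
  then show ?thesis using that \<phi> by (simp add: mult_2 add.assoc)
qed

lemma IP_if_trace_defines:
  fixes L :: "('f, 'r) language"
  assumes tr: "theory_trace_defines TYPE('u) L T binary_language G"
    and G: "finite_graphs \<subseteq> age binary_language G"
  shows "has_IP TYPE('u) L T"
proof -
  obtain N :: "('f, 'r, 'u) struct" and n \<tau> where N: "is_model L T N"
    and \<tau>: "trace_definition L N binary_language G n \<tau>"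
    using tr by (auto simp: theory_trace_defines_def struct_trace_defines_def)
  have t: "\<tau> x \<in> tuples n (universe N)" if "x \<in> universe G" for x
    using \<tau> that by (simp add: trace_definition_def)
  obtain \<phi> ps where \<phi>: "wf_form L \<phi>" "set ps \<subseteq> universe N" "free_vars \<phi> \<subseteq> {..<n + (n + length ps)}"
    "\<And>x y. x \<in> universe G \<Longrightarrow> y \<in> universe G \<Longrightarrow>
       rel_of G () [x, y] \<longleftrightarrow> sat N (nth (\<tau> x @ \<tau> y @ ps)) \<phi>"
    using trace_definition_binaryE[OF \<tau>] by blast
  have "shatters N n (n + length ps) \<phi> m" for m
  proof -
    \<comment> \<open>The bipartite membership graph between the numbers below \<open>m\<close> and the sets of such numbers.\<close>
    obtain c :: "nat set \<Rightarrow> nat" where c: "inj_on c (Pow {..<m})"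
      using finite_imp_inj_to_nat_seg[of "Pow {..<m}"] by auto
    \<comment> \<open>Shifting by \<open>m\<close> keeps the vertices for sets apart from the
      numbers below \<open>m\<close>.\<close>
    define p where "p I = m + c I" for I
    have p: "p I = p J \<longleftrightarrow> I = J" if "I \<subseteq> {..<m}" "J \<subseteq> {..<m}" for I J
      using inj_on_eq_iff[OF c, of I J] that by (simp add: p_def)
    define V where "V = insert 0 ({..<m} \<union> p ` Pow {..<m})"
    \<comment> \<open>Graphs are symmetric, hence both orientations. By the shift no vertex is
      joined to itself, and \<open>(i, p I)\<close> can arise in only one of the two
      orientations.\<close>
    define E where "E = {(x, y). \<exists>i I. i \<in> I \<and> I \<subseteq> {..<m} \<and> (x = i \<and> y = p I \<or> x = p I \<and> y = i)}"
    define H where "H = binary_struct V E"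
    have "H \<in> finite_graphs"
      by (auto simp: finite_graphs_def finite_binary_structs_def is_struct_binary H_def
          binary_struct_def V_def E_def p_def)
    then obtain h where h: "embedding binary_language H G h" using G by (auto simp: age_def)
    have hV: "h x \<in> universe G" if "x \<in> V" for x
      using h that by (auto simp: embedding_binary H_def binary_struct_def)
    have hE: "rel_of G () [h x, h y] \<longleftrightarrow> (x, y) \<in> E" if "x \<in> V" "y \<in> V" for x y
      using h that by (auto simp: embedding_binary H_def binary_struct_def)
    have "(i, p I) \<in> E \<longleftrightarrow> i \<in> I" if "i < m" "I \<subseteq> {..<m}" for i I
    proof
      assume "(i, p I) \<in> E"
      then show "i \<in> I" using that p by (auto simp: E_def p_def)
    qed (use that in \<open>auto simp: E_def\<close>)
    moreover have V: "i \<in> V" "p I \<in> V" if "i < m" "I \<subseteq> {..<m}" for i I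
      using that by (auto simp: V_def)
    ultimately have "sat N (nth (\<tau> (h i) @ \<tau> (h (p I)) @ ps)) \<phi> \<longleftrightarrow> i \<in> I"
      if "i < m" "I \<subseteq> {..<m}" for i I
      using that \<phi>(4)[of "h i" "h (p I)"] hE[of i "p I"] hV by simp
    moreover have "\<tau> (h i) \<in> tuples n (universe N)" if "i < m" for i
      using t hV V(1)[of i "{}"] that by simp
    moreover have "\<tau> (h (p I)) @ ps \<in> tuples (n + length ps) (universe N)" if "I \<subseteq> {..<m}" for I
    proof -
      have "p I \<in> V" using that by (auto simp: V_def)
      then show ?thesis using t[OF hV] \<phi>(2) by (auto simp: tuples_def)
    qed
    ultimately show ?thesis unfolding shatters_def
      by (intro exI[of _ "\<lambda>i. \<tau> (h i)"] exI[of _ "\<lambda>I. \<tau> (h (p I)) @ ps"]) simp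
  qed
  then show ?thesis using N \<phi>(1,3) unfolding has_IP_def by blast
qed

text \<open>Both Fraisse limits are covered at once: ultrahomogeneity serves one direction, an age
  containing all finite graphs the other.\<close>

lemma IP_iff_trace_defines_fraisse_limit:
  assumes "T \<subseteq> sentences L" "large_type TYPE('u) L"
    and "fraisse_limit binary_language K G" "finite_graphs \<subseteq> K"
  shows "has_IP TYPE('u) L T \<longleftrightarrow> theory_trace_defines TYPE('u) L T binary_language G"
  using assms trace_defines_ultrahomogeneous_if_IP IP_if_trace_defines
  unfolding fraisse_limit_def by blast

text \<open>Either the order has an infinite descending chain, or it is well founded on
  \<open>A\<close> and removing least elements forever yields an ascending one.\<close>

lemma infinite_linear_order_monotone_sequence:
  assumes A: "infinite A" and r: "strict_linear_order_on A r"
  obtains x :: "nat \<Rightarrow> 'a" where "range x \<subseteq> A"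
    "(\<forall>i j. (x i, x j) \<in> r \<longleftrightarrow> i < j) \<or> (\<forall>i j. (x i, x j) \<in> r \<longleftrightarrow> j < i)"
proof -
  have tr: "trans r" and ir: "irrefl r" and tot: "total_on A r"
    using r by (auto simp: strict_linear_order_on_def)
  \<comment> \<open>Stated for a general relation because it is used for \<open>r\<close> and for
    its converse.\<close>
  have mono: "(\<forall>i j. (x i, x j) \<in> s \<longleftrightarrow> i < j)"
    if "trans s" "irrefl s" "\<And>i. (x i, x (Suc i)) \<in> s" for x :: "nat \<Rightarrow> 'a" and s
  proof -
    have less: "(x i, x j) \<in> s" if "i < j" for i j
      using that
    proof (induction j)
      case (Suc j)
      then show ?case using \<open>trans s\<close> \<open>(x j, x (Suc j)) \<in> s\<close> by (metis less_Suc_eq transD)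
    qed simp
    have "i < j" if "(x i, x j) \<in> s" for i j
      using that less[of j i] \<open>trans s\<close> \<open>irrefl s\<close> by (metis irrefl_def linorder_neqE_nat transD)
    then show ?thesis using less by blast
  qed
  show ?thesis
  \<comment> \<open>\<open>r\<close> is total on \<open>A\<close> but may also contain pairs outside
    it, which must not enter the chain.\<close>
  proof (cases "wf (r \<inter> A \<times> A)")
    case False
    then obtain x where x: "\<And>i. (x (Suc i), x i) \<in> r \<inter> A \<times> A"
      unfolding wf_iff_no_infinite_down_chain by blast
    have "\<forall>i j. (x i, x j) \<in> r\<inverse> \<longleftrightarrow> i < j"
      using tr ir x by (intro mono) (auto simp: irrefl_def)
    then have "\<forall>i j. (x i, x j) \<in> r \<longleftrightarrow> j < i" by auto
    moreover have "range x \<subseteq> A" using x by auto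
    ultimately show ?thesis using that by blast
  next
    case True
    define mn where "mn B = (SOME z. z \<in> B \<and> (\<forall>y\<in>B. y \<noteq> z \<longrightarrow> (z, y) \<in> r))" for B
    have mn: "mn B \<in> B" "\<And>y. y \<in> B \<Longrightarrow> y \<noteq> mn B \<Longrightarrow> (mn B, y) \<in> r" if "B \<subseteq> A" "B \<noteq> {}" for B
    proof -
      obtain z where "z \<in> B" "\<And>y. (y, z) \<in> r \<inter> A \<times> A \<Longrightarrow> y \<notin> B"
        using True \<open>B \<noteq> {}\<close> by (metis all_not_in_conv wfE_min)
      then have "\<exists>z. z \<in> B \<and> (\<forall>y\<in>B. y \<noteq> z \<longrightarrow> (z, y) \<in> r)"
        using tot \<open>B \<subseteq> A\<close> unfolding total_on_def by (metis IntI SigmaI subsetD)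
      from someI_ex[OF this] show "mn B \<in> B" "\<And>y. y \<in> B \<Longrightarrow> y \<noteq> mn B \<Longrightarrow> (mn B, y) \<in> r"
        by (auto simp: mn_def)
    qed
    \<comment> \<open>\<open>A\<close> without its first \<open>i\<close> least elements; removing
      one element at a time never exhausts an infinite set.\<close>
    define B where "B i = ((\<lambda>C. C - {mn C}) ^^ i) A" for i :: nat
    have B: "B i \<subseteq> A \<and> infinite (B i)" for i
      by (induction i) (use A in \<open>auto simp: B_def\<close>)
    have Bi: "B i \<subseteq> A" "B i \<noteq> {}" for i using B[of i] by auto
    have "(mn (B i), mn (B (Suc i))) \<in> r" for i
      using mn(1)[OF Bi, of "Suc i"] mn(2)[OF Bi, of _ i] by (simp add: B_def)
    then have "\<forall>i j. (mn (B i), mn (B j)) \<in> r \<longleftrightarrow> i < j" by (intro mono tr ir)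
    moreover have "range (\<lambda>i. mn (B i)) \<subseteq> A" using mn(1)[OF Bi] Bi(1) by blast
    ultimately show ?thesis using that by blast
  qed
qed

lemma unstable_if_trace_defines_linear_order:
  fixes L :: "('f, 'r) language"
  assumes A: "infinite A" "strict_linear_order_on A r"
    and tr: "theory_trace_defines TYPE('u) L T binary_language (binary_struct A r)"
  shows "unstable TYPE('u) L T"
proof -
  obtain N :: "('f, 'r, 'u) struct" and n \<tau> where N: "is_model L T N"
    and \<tau>: "trace_definition L N binary_language (binary_struct A r) n \<tau>"
    using tr by (auto simp: theory_trace_defines_def struct_trace_defines_def)
  have t: "\<tau> x \<in> tuples n (universe N)" if "x \<in> A" for x
    using \<tau> that by (simp add: trace_definition_def binary_struct_def)
  obtain \<phi> ps where \<phi>: "wf_form L \<phi>" "set ps \<subseteq> universe N" "free_vars \<phi> \<subseteq> {..<n + (n + length ps)}"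
    and sat: "\<And>x y. x \<in> A \<Longrightarrow> y \<in> A \<Longrightarrow> (x, y) \<in> r \<longleftrightarrow> sat N (nth (\<tau> x @ \<tau> y @ ps)) \<phi>"
    using trace_definition_binaryE[OF \<tau>] by (simp add: binary_struct_def) blast
  obtain x where x: "range x \<subseteq> A"
    "(\<forall>i j :: nat. (x i, x j) \<in> r \<longleftrightarrow> i < j) \<or> (\<forall>i j. (x i, x j) \<in> r \<longleftrightarrow> j < i)"
    using infinite_linear_order_monotone_sequence[OF A] by blast
  have tup: "\<tau> (x i) \<in> tuples n (universe N)" "\<tau> (x i) @ ps \<in> tuples (n + length ps) (universe N)" for i
    using t[of "x i"] x(1) \<phi>(2) by (auto simp: tuples_def)
  have sat': "sat N (nth (\<tau> (x i) @ \<tau> (x j) @ ps)) \<phi> \<longleftrightarrow> (x i, x j) \<in> r" for i j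
    using sat[of "x i" "x j"] x(1) by auto
  have "\<exists>\<psi>. wf_form L \<psi> \<and> free_vars \<psi> \<subseteq> {..<n + (n + length ps)} \<and>
      has_order_property N n (n + length ps) \<psi>"
    using x(2)
  proof
    assume "\<forall>i j. (x i, x j) \<in> r \<longleftrightarrow> i < j"
    then have "has_order_property N n (n + length ps) \<phi>"
      unfolding has_order_property_def using tup sat'
      by (intro exI[of _ "\<lambda>i. \<tau> (x i)"] exI[of _ "\<lambda>i. \<tau> (x i) @ ps"]) simp
    then show ?thesis using \<phi> by blast
  next
    \<comment> \<open>Negation gives \<open>i \<le> j\<close>; taking \<open>x (Suc i)\<close> on
      the left makes this strict.\<close>
    assume "\<forall>i j. (x i, x j) \<in> r \<longleftrightarrow> j < i"
    then have "has_order_property N n (n + length ps) (Neg \<phi>)"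
      unfolding has_order_property_def using tup sat'
      by (intro exI[of _ "\<lambda>i. \<tau> (x (Suc i))"] exI[of _ "\<lambda>i. \<tau> (x i) @ ps"]) auto
    then show ?thesis using \<phi> by (intro exI[of _ "Neg \<phi>"]) simp
  qed
  then show ?thesis using N unfolding unstable_def by blast
qed

text \<open>The orders in question live on subsets of the infinite type \<open>'o\<close>, so the
  rationals are copied there by way of the naturals.\<close>

lemma trace_defines_linear_order_if_rat_order:
  fixes L :: "('f, 'r) language"
  assumes "infinite (UNIV :: 'o set)"
    and tr: "theory_trace_defines TYPE('u) L T binary_language rat_order"
  shows "\<exists>(A :: 'o set) r. infinite A \<and> strict_linear_order_on A r \<and>
    theory_trace_defines TYPE('u) L T binary_language (binary_struct A r)"
proof -
  obtain f :: "nat \<Rightarrow> 'o" where f: "inj f"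
    using assms(1) infinite_countable_subset by blast
  define g where "g = f \<circ> to_nat_on (UNIV :: rat set)"
  have g: "inj g"
    unfolding g_def by (rule inj_compose[OF f inj_on_to_nat_on]) simp
  define r where "r = {(g p, g q) | p q. p < q}"
  have r: "(g p, g q) \<in> r \<longleftrightarrow> p < q" for p q using g by (auto simp: r_def inj_def)
  have inf: "infinite (range g)" using g by (simp add: finite_image_iff infinite_UNIV_char_0)
  have lin: "strict_linear_order_on (range g) r"
    unfolding strict_linear_order_on_def
  proof (intro conjI)
    show "trans r"
    proof (rule transI)
      fix x y z assume "(x, y) \<in> r" "(y, z) \<in> r"
      then obtain p q s t where "x = g p" "y = g q" "p < q" "y = g s" "z = g t" "s < t"
        by (auto simp: r_def)
      moreover from this have "q = s" using g by (simp add: inj_eq)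
      ultimately show "(x, z) \<in> r" by (simp add: r)
    qed
    show "irrefl r" using g by (auto simp: irrefl_def r_def inj_def)
    show "total_on (range g) r" by (auto simp: total_on_def r inj_eq[OF g] neq_iff)
  qed
  obtain N :: "('f, 'r, 'u) struct" and n \<tau> where N: "is_model L T N"
    and \<tau>: "trace_definition L N binary_language rat_order n \<tau>"
    using tr by (auto simp: theory_trace_defines_def struct_trace_defines_def)
  have "isomorphism binary_language (binary_struct (range g) r) rat_order (inv g)"
    unfolding isomorphism_def embedding_binary using g
    by (auto simp: binary_struct_def r inj_on_def image_image)
  from trace_definition_isomorphism[OF \<tau> _ this]
  have "trace_definition L N binary_language (binary_struct (range g) r) n (\<tau> \<circ> inv g)"
    by (simp add: is_struct_binary binary_struct_def)
  then show ?thesis using N inf lin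
    unfolding theory_trace_defines_def struct_trace_defines_def by blast
qed

theorem theoremA:
  fixes L :: "('f, 'r) language" and T :: "('f, 'r) form set"
  assumes "large_type TYPE('u) L"
    and "infinite (UNIV :: 'o set)"
    and "complete_theory TYPE('u) L T"
  shows
    "((unstable TYPE('u) L T \<longleftrightarrow> theory_trace_defines TYPE('u) L T binary_language rat_order) \<and>
      (theory_trace_defines TYPE('u) L T binary_language rat_order \<longleftrightarrow>
        (\<exists>(A :: 'o set) r. infinite A \<and> strict_linear_order_on A r \<and>
           theory_trace_defines TYPE('u) L T binary_language (binary_struct A r)))) \<and>
     (\<forall>(G :: (unit, unit, 'g) struct) (R :: (unit, unit, 'h) struct).
        is_erdos_rado_graph G \<and> is_generic_binary_relation R \<longrightarrow>
        (has_IP TYPE('u) L T \<longleftrightarrow> theory_trace_defines TYPE('u) L T binary_language G) \<and>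
        (theory_trace_defines TYPE('u) L T binary_language G \<longleftrightarrow>
         theory_trace_defines TYPE('u) L T binary_language R))"
proof -
  have T: "T \<subseteq> sentences L" using assms(3) by (simp add: complete_theory_def)
  have "has_IP TYPE('u) L T \<longleftrightarrow> theory_trace_defines TYPE('u) L T binary_language G"
    if "is_erdos_rado_graph G" for G :: "(unit, unit, 'g) struct"
    by (rule IP_iff_trace_defines_fraisse_limit[OF T assms(1) that[unfolded is_erdos_rado_graph_def]]) simp
  moreover have "has_IP TYPE('u) L T \<longleftrightarrow> theory_trace_defines TYPE('u) L T binary_language R"
    if "is_generic_binary_relation R" for R :: "(unit, unit, 'h) struct"
    by (rule IP_iff_trace_defines_fraisse_limit[OF T assms(1) that[unfolded is_generic_binary_relation_def]])
      (auto simp: finite_graphs_def)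
  \<comment> \<open>Instability gives a trace of the rationals, this gives one of an infinite linear
    order, and that gives instability again. The graph and the generic relation are compared through
    \<open>has_IP\<close>.\<close>
  ultimately show ?thesis
    using trace_defines_rat_order_if_unstable[OF T assms(1)]
      trace_defines_linear_order_if_rat_order[OF assms(2)] unstable_if_trace_defines_linear_order
    by blast
qed

end
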